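(* Let $|N|\geq 4$ and $|O|\geq 3$, and let $f:\mathcal{R}^N\rightarrow\Delta(\mathcal{M})$ be a mechanism. (i) If $f$ satisfies equal treatment of almost equals, strategy-proofness and ex-post weak non-wastefulness, then $f$ is $q$-agent-object-wasteful for some $q\geq \frac{1}{6}$. (ii) If $f$ satisfies equal treatment of equals, strategy-proofness and ex-post efficiency, then $f$ is $q$-agent-object-wasteful for some $q\geq \frac{1}{6}$.
   Context: Model. $N=\{1,\ldots,n\}$ is a finite set of agents and $O$ a finite set of objects. Each agent $i$ has a strict preference $R_i$, a linear order over $O\cup\{i\}$, where $i$ stands for being unassigned; $P_i$ is its asymmetric part. $A(R_i)=\{o\in O: oP_ii\}$ is the set of acceptable objects, and $R_i|O$ is the restriction of $R_i$ to $O$ (the ranking of all objects, acceptable or not). $\mathcal{R}^i$ is the set of all linear orders over $O\cup\{i\}$ and $\mathcal{R}^N=\times_{i\in N}\mathcal{R}^i$ is the set of profiles $R=(R_i)_{i\in N}$. An assignment is a map $\mu$ on $N$ with $\mu_i\in O\cup\{i\}$ for all $i$ and $\mu_i\neq\mu_j$ for $i\neq j$; $\mathcal{M}$ is the set of assignments and $\Delta(\mathcal{M})$ the set of probability distributions over $\mathcal{M}$. For $p\in\Delta(\mathcal{M})$, $p_{ia}$ is the probability that $i$ is assigned $a\in O\cup\{i\}$ and $p_i=(p_{ia})_{a\in O\cup\{i\}}$. A mechanism is a map $f:\mathcal{R}^N\to\Delta(\mathcal{M})$; $f_{ia}(R)$, $f_i(R)$ denote the corresponding probabilities, and $f_{oo}(R)=1-\sum_{j\in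 N}f_{jo}(R)$ for $o\in O$. Properties. An assignment $\mu$ is efficient under $R$ if there is no assignment $\mu'$ with $\mu'_iR_i\mu_i$ for all $i$ and $\mu'_jP_j\mu_j$ for some $j$. It is weakly non-wasteful under $R$ if for all $i\in N$ and $x\in O\cup\{i\}$: $xR_i\mu_i$ and $iR_i\mu_i$ together imply that $\mu_j=x$ for some $j\in N$ (i.e. no agent gets an unacceptable object, and no unassigned agent finds acceptable an unassigned object). $f$ is ex-post efficient (resp. ex-post weakly non-wasteful) if for every $R$ every assignment in the support of $f(R)$ is efficient (resp. weakly non-wasteful) under $R$. $f$ is strategy-proof if for all $R$, $i$, and $R_i'\in\mathcal{R}^i$, $f_i(R)$ stochastically $R_i$-dominates $f_i(R_i',R_{-i})$, i.e. $\sum_{y:\,yR_ix}f_{iy}(R)\ge\sum_{y:\,yR_ix}f_{iy}(R_i',R_{-i})$ for all $x\in O\cup\{i\}$. $f$ satisfies equal treatment of equals if for all $R$ and $i,j\in N$, if $R_i=R_j$ (identifying the outside options $i$ and $j$) then $f_{io}(R)=f_{jo}(R)$ for all $o\in O$. $f$ satisfies equal treatment of almost equals if for all $R$ and all $i,j\in N$ with $R_i|O=R_j|O$ and $|A(R_i)|\le|A(R_j)|\le|A(R_i)|+1$, we have $f_{iy}(R)=f_{jy}(R)$ for all $y\in A(R_i)$. Waste. For $q\in[0,1]$, $f$ is $q$-agent-object-wasteful if there exist a profile $R$, $o\in O$ and $i\in N$ with $oP_ii$ and $\min\{f_{ii}(R),f_{oo}(R)\}\ge q$. *)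

theory Defs
  imports "HOL-Probability.Probability_Mass_Function"
begin

text \<open>
  Agents and objects are the elements of finite types \<open>'n\<close> and \<open>'o\<close>.  The set of
  objects together with the outside option of an agent \<open>i\<close> is rendered as \<open>'o option\<close>,
  where \<open>Some x\<close> is the object \<open>x\<close> and, in a preference of \<open>i\<close> or at the \<open>i\<close>-th
  component of an assignment, \<open>None\<close> is the outside option of that agent \<open>i\<close>.
  So \<open>None\<close> means different outside options for different agents, and equality of the
  preferences of two agents is equality up to identifying their outside options.
  A pair \<open>(x, y)\<close> in a preference means that \<open>x\<close> is weakly preferred to \<open>y\<close>.
\<close>

type_synonym 'o pref = "'o option rel"
type_synonym ('n, 'o) profile = "'n \<Rightarrow> 'o pref"
type_synonym ('n, 'o) alloc = "'n \<Rightarrow> 'o option"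
type_synonym ('n, 'o) mech = "('n, 'o) profile \<Rightarrow> ('n, 'o) alloc pmf"

definition preferences :: "'o pref set" where
  "preferences = {r. linear_order_on UNIV r}"

definition profiles :: "('n, 'o) profile set" where
  "profiles = {R. \<forall>i. R i \<in> preferences}"

definition strict :: "'o pref \<Rightarrow> 'o option \<Rightarrow> 'o option \<Rightarrow> bool" where
  "strict r x y \<longleftrightarrow> (x, y) \<in> r \<and> (y, x) \<notin> r"

definition acceptable :: "'o pref \<Rightarrow> 'o set" where
  "acceptable r = {x. strict r (Some x) None}"

definition restrict_objects :: "'o pref \<Rightarrow> 'o rel" where
  "restrict_objects r = {(x, y). (Some x, Some y) \<in> r}"

text \<open>Outside options of different agents are distinct, so only objects can be assigned twice.\<close>

definition assignments :: "('n, 'o) alloc set" where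
  "assignments = {\<mu>. \<forall>i j x. i \<noteq> j \<longrightarrow> \<mu> i = Some x \<longrightarrow> \<mu> j \<noteq> Some x}"

text \<open>
  Only the values of a mechanism at elements of \<^const>\<open>profiles\<close> matter: its values at
  other arguments are unconstrained, and all properties below ignore them.
\<close>

definition mechanism :: "('n, 'o) mech \<Rightarrow> bool" where
  "mechanism f \<longleftrightarrow> (\<forall>R\<in>profiles. set_pmf (f R) \<subseteq> assignments)"

definition share :: "('n, 'o) alloc pmf \<Rightarrow> 'n \<Rightarrow> 'o option \<Rightarrow> real" where
  "share p i a = measure_pmf.prob p {\<mu>. \<mu> i = a}"

definition unassigned_share :: "('n::finite, 'o) alloc pmf \<Rightarrow> 'o \<Rightarrow> real" where
  "unassigned_share p x = 1 - (\<Sum>j\<in>UNIV. share p j (Some x))"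

definition efficient :: "('n, 'o) profile \<Rightarrow> ('n, 'o) alloc \<Rightarrow> bool" where
  "efficient R \<mu> \<longleftrightarrow>
     \<not> (\<exists>\<mu>'\<in>assignments. (\<forall>i. (\<mu>' i, \<mu> i) \<in> R i) \<and> (\<exists>j. strict (R j) (\<mu>' j) (\<mu> j)))"

text \<open>
  The outside option of \<open>i\<close> can only be taken by \<open>i\<close> itself, hence the case distinction:
  \<open>\<exists>j. \<mu> j = None\<close> would be too weak.
\<close>

definition weakly_non_wasteful :: "('n, 'o) profile \<Rightarrow> ('n, 'o) alloc \<Rightarrow> bool" where
  "weakly_non_wasteful R \<mu> \<longleftrightarrow>
     (\<forall>i x. (x, \<mu> i) \<in> R i \<and> (None, \<mu> i) \<in> R i \<longrightarrow>
        (case x of None \<Rightarrow> \<mu> i = None | Some y \<Rightarrow> (\<exists>j. \<mu> j = Some y)))"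

definition ex_post_efficient :: "('n, 'o) mech \<Rightarrow> bool" where
  "ex_post_efficient f \<longleftrightarrow> (\<forall>R\<in>profiles. \<forall>\<mu>\<in>set_pmf (f R). efficient R \<mu>)"

definition ex_post_weakly_non_wasteful :: "('n, 'o) mech \<Rightarrow> bool" where
  "ex_post_weakly_non_wasteful f \<longleftrightarrow>
     (\<forall>R\<in>profiles. \<forall>\<mu>\<in>set_pmf (f R). weakly_non_wasteful R \<mu>)"

definition strategy_proof :: "('n, 'o::finite) mech \<Rightarrow> bool" where
  "strategy_proof f \<longleftrightarrow>
     (\<forall>R\<in>profiles. \<forall>i. \<forall>r\<in>preferences. \<forall>x.
        (\<Sum>y | (y, x) \<in> R i. share (f R) i y) \<ge> (\<Sum>y | (y, x) \<in> R i. share (f (R(i := r))) i y))"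

definition equal_treatment_of_equals :: "('n, 'o) mech \<Rightarrow> bool" where
  "equal_treatment_of_equals f \<longleftrightarrow>
     (\<forall>R\<in>profiles. \<forall>i j. R i = R j \<longrightarrow>
        (\<forall>x. share (f R) i (Some x) = share (f R) j (Some x)))"

definition equal_treatment_of_almost_equals :: "('n, 'o::finite) mech \<Rightarrow> bool" where
  "equal_treatment_of_almost_equals f \<longleftrightarrow>
     (\<forall>R\<in>profiles. \<forall>i j.
        restrict_objects (R i) = restrict_objects (R j) \<and>
        card (acceptable (R i)) \<le> card (acceptable (R j)) \<and>
        card (acceptable (R j)) \<le> card (acceptable (R i)) + 1 \<longrightarrow>
        (\<forall>y\<in>acceptable (R i). share (f R) i (Some y) = share (f R) j (Some y)))"

definition agent_object_wasteful :: "real \<Rightarrow> ('n::finite, 'o) mech \<Rightarrow> bool" where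
  "agent_object_wasteful q f \<longleftrightarrow>
     (\<exists>R\<in>profiles. \<exists>x i. strict (R i) (Some x) None \<and>
        min (share (f R) i None) (unassigned_share (f R) x) \<ge> q)"

end

theory Submission
  imports Defs
begin

text \<open>
  Four agents \<open>i, j, k, l\<close> compete for three objects \<open>a, b, c\<close>; everybody else accepts nothing.
  In the profile where they report \<open>ab\<close>, \<open>ab\<close>, \<open>acb\<close>, \<open>bc\<close> (acceptable objects in decreasing
  order), \<open>l\<close> stays unassigned and \<open>c\<close> stays unassigned with probability at least \<open>1/6\<close> each,
  which random serial dictatorship attains.

  Strategy-proofness fixes the total share of every initial segment of an agent's ranking, equal
  treatment equates agents with the same report, and by non-wastefulness every object that is
  demanded enough is assigned for sure.  Starting from symmetric profiles, where these linear
  equations have a unique solution, one changes one report at a time until the target is reached.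

  The two parts of the theorem differ only in why certain shares vanish and in why \<open>j\<close> receives
  \<open>b\<close> with probability \<open>5/12\<close> under \<open>ab\<close>, \<open>abc\<close>, \<open>acb\<close>, \<open>acb\<close>.  Under equal treatment of almost
  equals, agents who drop an object from the end of their list keep equal shares of the rest; under
  ex-post efficiency, vanishing shares come from profitable exchanges, and the value \<open>5/12\<close> from a
  detour through profiles containing \<open>bac\<close>.
\<close>

section \<open>Preferences given by rankings\<close>

text \<open>
  \<open>ranking u v\<close> ranks the objects of \<open>u\<close>, then the outside option, then the objects of \<open>v\<close>; all
  remaining objects come last, in an arbitrary but fixed order.
\<close>

definition rank :: "'a::finite list \<Rightarrow> 'a \<Rightarrow> nat" where
  "rank xs x = length (takeWhile (\<lambda>z. z \<noteq> x) xs) + (if x \<in> set xs then 0 else to_nat_on UNIV x)"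

lemma rank_append_in: "x \<in> set u \<Longrightarrow> rank (u @ v) x = rank u x"
  by (simp add: rank_def takeWhile_append1)

lemma rank_append_notin: "x \<notin> set u \<Longrightarrow> rank (u @ v) x = length u + rank v x"
  by (induction u) (auto simp: rank_def)

lemma rank_Cons: "rank (z # v) x = (if z = x then 0 else Suc (rank v x))"
  by (simp add: rank_def)

lemma rank_less_length: "x \<in> set u \<Longrightarrow> rank u x < length u"
  unfolding rank_def by (induction u) auto

lemma rank_less: "x \<in> set u \<Longrightarrow> y \<notin> set u \<Longrightarrow> rank (u @ v) x < rank (u @ v) y"
  using rank_less_length[of x u] by (simp add: rank_append_in rank_append_notin)

lemma rank_inj: "rank u x = rank u y \<Longrightarrow> x = y"
proof (induction u)
  case Nil
  then show ?case
    using inj_on_to_nat_on[of "UNIV :: 'a set"] by (auto simp: rank_def inj_on_def countable_finite)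
next
  case (Cons z u)
  then show ?case by (auto simp: rank_def split: if_splits)
qed

definition ranking :: "'o::finite list \<Rightarrow> 'o list \<Rightarrow> 'o pref" where
  "ranking u v = {(x, y). rank (map Some u @ None # map Some v) x \<le> rank (map Some u @ None # map Some v) y}"

lemma ranking_in_preferences [simp]: "ranking u v \<in> preferences"
  unfolding preferences_def ranking_def linear_order_on_def partial_order_on_def preorder_on_def
    refl_on_def trans_def antisym_def total_on_def
  by (auto dest: rank_inj intro: antisym)

lemma strict_ranking:
  "strict (ranking u v) x y \<longleftrightarrow> rank (map Some u @ None # map Some v) x < rank (map Some u @ None # map Some v) y"
  by (auto simp: strict_def ranking_def)

lemma strict_ranking_prefix:
  assumes "Some x \<in> Some ` set w" "y \<notin> Some ` set w"
  shows "strict (ranking (w @ u) v) (Some x) y"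
  using rank_less[of "Some x" "map Some w" y "map Some u @ None # map Some v"] assms
  by (simp add: strict_ranking)

lemma strict_ranking_None: "strict (ranking u v) (Some x) None \<longleftrightarrow> x \<in> set u"
proof -
  have "rank (map Some u @ None # map Some v) None = length u"
    using rank_append_notin[of None "map Some u"] by (simp add: rank_def)
  moreover have "rank (map Some u @ None # map Some v) (Some x) < length u \<longleftrightarrow> x \<in> set u"
    using rank_less_length[of "Some x" "map Some u"]
      rank_append_in[of "Some x" "map Some u"] rank_append_notin[of "Some x" "map Some u"]
    by (cases "x \<in> set u") force+
  ultimately show ?thesis by (simp add: strict_ranking)
qed

lemma acceptable_ranking [simp]: "acceptable (ranking u v) = set u"
  by (simp add: acceptable_def strict_ranking_None)

text \<open>Inserting the outside option pushes back by one exactly the objects outside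
  \<open>u\<close>, which come after those of \<open>u\<close> anyway. Reports that differ only in
  the position of the outside option are thereby recognised as almost equal.\<close>

lemma restrict_objects_ranking:
  "restrict_objects (ranking u v) =
     {(x, y). rank (map Some (u @ v)) (Some x) \<le> rank (map Some (u @ v)) (Some y)}"
proof -
  have r: "rank (map Some u @ None # map Some v) (Some x) =
      rank (map Some u @ map Some v) (Some x) + (if x \<in> set u then 0 else 1)" for x
  proof (cases "x \<in> set u")
    case True
    then show ?thesis by (simp add: rank_append_in)
  next
    case False
    then have "Some x \<notin> set (map Some u)" by auto
    from rank_append_notin[OF this] False show ?thesis by (simp add: rank_Cons)
  qed
  have less: "rank (map Some u @ map Some v) (Some x) < rank (map Some u @ map Some v) (Some y)"
    if "x \<in> set u" "y \<notin> set u" for x y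
    using that by (intro rank_less) auto
  have "rank (map Some u @ None # map Some v) (Some x) \<le> rank (map Some u @ None # map Some v) (Some y) \<longleftrightarrow>
      rank (map Some u @ map Some v) (Some x) \<le> rank (map Some u @ map Some v) (Some y)" for x y
    using less[of x y] less[of y x] by (auto simp: r)
  then show ?thesis
    by (auto simp: restrict_objects_def ranking_def)
qed

text \<open>The sums in \<open>strategy_proof\<close> range over upper contour sets, which become
  initial segments of the list.\<close>

lemma upper_set_ranking:
  assumes "distinct (w @ [x])"
  shows "{y. (y, Some x) \<in> ranking (w @ x # u) v} = Some ` set (w @ [x])"
proof -
  let ?l = "map Some (w @ [x]) @ map Some u @ None # map Some v"
  have x: "rank ?l (Some x) = length w"
    using assms rank_append_notin[of "Some x" "map Some w" "Some x # map Some u @ None # map Some v"]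
    by (auto simp: rank_def)
  have "rank ?l y \<le> length w \<longleftrightarrow> y \<in> Some ` set (w @ [x])" for y
  proof (cases "y \<in> Some ` set (w @ [x])")
    case True
    then show ?thesis
      using rank_less_length[of y "map Some (w @ [x])"] rank_append_in[of y "map Some (w @ [x])" "map Some u @ None # map Some v"]
      by simp
  next
    case False
    then show ?thesis
      using rank_append_notin[of y "map Some (w @ [x])" "map Some u @ None # map Some v"] by simp
  qed
  then show ?thesis using x by (auto simp: ranking_def)
qed

section \<open>Shares\<close>

lemma share_nonneg: "0 \<le> share p i x"
  by (simp add: share_def)

lemma sum_share: "(\<Sum>x\<in>UNIV. share p i (x :: 'o::finite option)) = 1"
proof -
  have "share p i x = pmf (map_pmf (\<lambda>\<mu>. \<mu> i) p) x" for x
    by (simp add: share_def pmf_map vimage_def)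
  then show ?thesis by (simp add: sum_pmf_eq_1)
qed

text \<open>Double counting: both sides are the expected number of agents holding \<open>x\<close>.
  Facts about each assignment in the support thus turn into facts about sums of shares.\<close>

lemma share_sum_column:
  fixes p :: "('n::finite, 'o::finite) alloc pmf"
  shows "(\<Sum>j\<in>UNIV. share p j x) = (\<Sum>\<mu>\<in>set_pmf p. pmf p \<mu> * card {j. \<mu> j = x})"
proof -
  have "share p j x = (\<Sum>\<mu>\<in>UNIV. pmf p \<mu> * of_bool (\<mu> j = x))" for j
    unfolding share_def by (simp add: measure_measure_pmf_finite sum.If_cases of_bool_def if_distrib cong: if_cong)
  then have "(\<Sum>j\<in>UNIV. share p j x) = (\<Sum>\<mu>\<in>UNIV. \<Sum>j\<in>UNIV. pmf p \<mu> * of_bool (\<mu> j = x))"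
    by (simp only: sum.swap[of _ "UNIV :: ('n, 'o) alloc set"])
  also have "\<dots> = (\<Sum>\<mu>\<in>UNIV. pmf p \<mu> * card {j. \<mu> j = x})"
    by (simp only: flip: sum_distrib_left) (simp add: of_bool_def sum.If_cases)
  also have "\<dots> = (\<Sum>\<mu>\<in>set_pmf p. pmf p \<mu> * card {j. \<mu> j = x})"
    by (rule sum.mono_neutral_right) (auto simp: set_pmf_iff)
  finally show ?thesis .
qed

lemma share_eq_0: "(\<And>\<mu>. \<mu> \<in> set_pmf p \<Longrightarrow> \<mu> i \<noteq> x) \<Longrightarrow> share p i x = 0"
  by (auto simp: share_def measure_pmf_zero_iff)

text \<open>Agents outside \<open>{i, j, k, l}\<close> find every object unacceptable.\<close>

definition pattern ::
  "('n, 'o::finite) profile \<Rightarrow> 'n \<Rightarrow> 'o pref \<Rightarrow> 'n \<Rightarrow> 'o pref \<Rightarrow> 'n \<Rightarrow> 'o pref \<Rightarrow> 'n \<Rightarrow> 'o pref \<Rightarrow> bool" where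
  "pattern R i w j x k y l z \<longleftrightarrow>
     distinct [i, j, k, l] \<and> R \<in> profiles \<and> R i = w \<and> R j = x \<and> R k = y \<and> R l = z \<and>
     (\<forall>m. m \<noteq> i \<longrightarrow> m \<noteq> j \<longrightarrow> m \<noteq> k \<longrightarrow> m \<noteq> l \<longrightarrow> R m = ranking [] [])"

lemma profiles_update [simp]: "R \<in> profiles \<Longrightarrow> r \<in> preferences \<Longrightarrow> R(i := r) \<in> profiles"
  by (auto simp: profiles_def)

section \<open>Consequences of fairness and strategy-proofness\<close>

locale non_wasteful_mechanism =
  fixes f :: "('n::finite, 'o::finite) mech"
  assumes mechanism: "mechanism f"
    and non_wasteful: "ex_post_weakly_non_wasteful f"
begin

abbreviation p :: "('n, 'o) profile \<Rightarrow> 'n \<Rightarrow> 'o \<Rightarrow> real" where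
  "p R i x \<equiv> share (f R) i (Some x)"

abbreviation q :: "('n, 'o) profile \<Rightarrow> 'n \<Rightarrow> real" where
  "q R i \<equiv> share (f R) i None"

text \<open>An agent holding an unacceptable object prefers its outside option, and the case
  \<open>x = None\<close> of weak non-wastefulness then makes it unassigned.\<close>

lemma support_acceptable:
  assumes "R \<in> profiles" "\<mu> \<in> set_pmf (f R)" "\<mu> i = Some x"
  shows "x \<in> acceptable (R i)"
proof (rule ccontr)
  assume *: "x \<notin> acceptable (R i)"
  have "linear_order (R i)" using assms(1) by (auto simp: profiles_def preferences_def)
  then have "(None, \<mu> i) \<in> R i"
    using * assms(3) by (auto simp: acceptable_def strict_def order_on_defs total_on_def)
  then have "\<mu> i = None"
    using non_wasteful assms(1,2)
    unfolding ex_post_weakly_non_wasteful_def weakly_non_wasteful_def by fastforce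
  then show False using assms(3) by simp
qed

lemma support_assigned:
  assumes "R \<in> profiles" "\<mu> \<in> set_pmf (f R)" "\<mu> i = None" "x \<in> acceptable (R i)"
  shows "\<exists>j. \<mu> j = Some x"
proof -
  have "linear_order (R i)" using assms(1) by (auto simp: profiles_def preferences_def)
  then have "(None, None) \<in> R i" by (auto simp: order_on_defs refl_on_def)
  moreover have "(Some x, None) \<in> R i"
    using assms(4) by (auto simp: acceptable_def strict_def)
  ultimately have "(Some x, \<mu> i) \<in> R i \<and> (None, \<mu> i) \<in> R i" using assms(3) by simp
  moreover have "weakly_non_wasteful R \<mu>"
    using non_wasteful assms(1,2) unfolding ex_post_weakly_non_wasteful_def by blast
  ultimately show ?thesis
    unfolding weakly_non_wasteful_def by (auto dest!: spec[of _ i] spec[of _ "Some x"])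
qed

lemma support_injective:
  assumes "R \<in> profiles" "\<mu> \<in> set_pmf (f R)" "\<mu> i = Some x" "\<mu> j = Some x"
  shows "i = j"
  using mechanism assms unfolding mechanism_def assignments_def by blast

lemma p_eq_0: "R \<in> profiles \<Longrightarrow> x \<notin> acceptable (R i) \<Longrightarrow> p R i x = 0"
  using support_acceptable by (intro share_eq_0) blast

lemma row:
  assumes "R \<in> profiles" "acceptable (R i) \<subseteq> S"
  shows "(\<Sum>x\<in>S. p R i x) + q R i = 1"
proof -
  have "(\<Sum>x\<in>S. p R i x) = (\<Sum>x\<in>UNIV. p R i x)"
    using assms p_eq_0 by (intro sum.mono_neutral_left) auto
  moreover have "(\<Sum>x\<in>UNIV. share (f R) i x) = q R i + (\<Sum>x\<in>UNIV. p R i x)"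
    by (simp add: UNIV_option_conv sum.reindex)
  ultimately show ?thesis using sum_share[of "f R" i] by simp
qed

lemma column_le: "R \<in> profiles \<Longrightarrow> (\<Sum>i\<in>UNIV. p R i x) \<le> 1"
proof -
  assume R: "R \<in> profiles"
  have "card {i. \<mu> i = Some x} \<le> 1" if "\<mu> \<in> set_pmf (f R)" for \<mu>
    using support_injective[OF R that] by (auto simp: card_le_Suc0_iff_eq)
  then have "(\<Sum>i\<in>UNIV. p R i x) \<le> (\<Sum>\<mu>\<in>set_pmf (f R). pmf (f R) \<mu> * 1)"
    unfolding share_sum_column
    by (intro sum_mono mult_left_mono) (auto simp flip: of_nat_le_iff)
  then show ?thesis by (simp add: sum_pmf_eq_1)
qed

lemma column_eq:
  assumes R: "R \<in> profiles" and "\<And>\<mu>. \<mu> \<in> set_pmf (f R) \<Longrightarrow> \<exists>i. \<mu> i = Some x"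
  shows "(\<Sum>i\<in>UNIV. p R i x) = 1"
proof -
  have "card {i. \<mu> i = Some x} = 1" if "\<mu> \<in> set_pmf (f R)" for \<mu>
    using support_injective[OF R that] assms(2)[OF that] by (auto simp: card_1_singleton_iff)
  then have "(\<Sum>i\<in>UNIV. p R i x) = (\<Sum>\<mu>\<in>set_pmf (f R). pmf (f R) \<mu>)"
    unfolding share_sum_column by (intro sum.cong) auto
  then show ?thesis by (simp add: sum_pmf_eq_1)
qed

text \<open>Pigeonhole: if \<open>x\<close> were left over, every agent of \<open>M\<close> would
  have to hold a different object of \<open>S\<close>, which is too small.\<close>

lemma column_demand:
  assumes R: "R \<in> profiles" and M: "\<forall>i\<in>M. x \<in> acceptable (R i) \<and> acceptable (R i) \<subseteq> insert x S"
    and "finite S" "card S < card M"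
  shows "(\<Sum>i\<in>UNIV. p R i x) = 1"
proof (rule column_eq[OF R], rule ccontr)
  fix \<mu> assume \<mu>: "\<mu> \<in> set_pmf (f R)" and n: "\<nexists>i. \<mu> i = Some x"
  have "\<exists>y\<in>S. \<mu> i = Some y" if i: "i \<in> M" for i
    using support_assigned[OF R \<mu>, of i x] support_acceptable[OF R \<mu>, of i] M i n
    by (cases "\<mu> i") auto
  then have "\<mu> ` M \<subseteq> Some ` S" by auto
  moreover have "inj_on \<mu> M"
    using support_injective[OF R \<mu>] \<open>\<mu> ` M \<subseteq> Some ` S\<close> unfolding inj_on_def by (metis image_iff image_subset_iff)
  ultimately have "card M \<le> card (Some ` S)"
    using \<open>finite S\<close> by (metis card_inj_on_le finite_imageI)
  then show False using assms(3,4) by (simp add: card_image)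
qed

end

section \<open>Linear equations from strategy-proofness, equal treatment and full assignment\<close>

locale fair_mechanism = non_wasteful_mechanism f
  for f :: "('n::finite, 'o::finite) mech" +
  fixes a b c :: 'o
  assumes strategy_proof: "strategy_proof f"
    and equals: "equal_treatment_of_equals f"
    and distinct_objects: "distinct [a, b, c]"
begin

lemma objects_neq [simp]: "a \<noteq> b" "b \<noteq> a" "a \<noteq> c" "c \<noteq> a" "b \<noteq> c" "c \<noteq> b"
  using distinct_objects by auto

text \<open>Strategy-proofness is applied at the last object of \<open>w\<close>, whose upper
  contour set is \<open>w\<close> itself.\<close>

lemma sp_le:
  assumes R: "R \<in> profiles" "R i = ranking (w @ u) v" "distinct w" "r \<in> preferences"
  shows "(\<Sum>x\<in>set w. p (R(i := r)) i x) \<le> (\<Sum>x\<in>set w. p R i x)"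
proof (cases w rule: rev_cases)
  case (snoc w' y)
  have "{z. (z, Some y) \<in> R i} = Some ` set w"
    using upper_set_ranking[of w' y u v] R(2,3) snoc by simp
  moreover have "(\<Sum>z | (z, Some y) \<in> R i. share (f (R(i := r))) i z) \<le> (\<Sum>z | (z, Some y) \<in> R i. share (f R) i z)"
    using strategy_proof R(1,4) unfolding strategy_proof_def by blast
  ultimately show ?thesis by (simp add: sum.reindex)
qed simp

text \<open>Both reports start with the same set of objects, so each is a misreport of the other and
  \<open>sp_le\<close> applies in both directions.\<close>

lemma sp_eq:
  assumes R: "R \<in> profiles" "R i = ranking (w @ u) v" "distinct w" "distinct w'" "set w' = set w"
  shows "(\<Sum>x\<in>set w. p (R(i := ranking (w' @ u') v')) i x) = (\<Sum>x\<in>set w. p R i x)"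
proof (rule antisym)
  have "R(i := ranking (w' @ u') v', i := R i) = R" by simp
  moreover have "R i \<in> preferences" using R(1) by (auto simp: profiles_def)
  ultimately show "(\<Sum>x\<in>set w. p R i x) \<le> (\<Sum>x\<in>set w. p (R(i := ranking (w' @ u') v')) i x)"
    using sp_le[of "R(i := ranking (w' @ u') v')" i w' u' v' "R i"] R by (simp del: fun_upd_upd)
qed (rule sp_le[OF R(1-3) ranking_in_preferences])

lemma sp1:
  assumes "R \<in> profiles" "R i = ranking (x # u) v"
  shows "p (R(i := ranking (x # u') v')) i x = p R i x"
  using sp_eq[of R i "[x]" u v "[x]" u' v'] assms by simp

lemma sp2:
  assumes "R \<in> profiles" "R i = ranking (x # y # u) v" "x \<noteq> y"
  shows "p (R(i := ranking (x # y # u') v')) i x + p (R(i := ranking (x # y # u') v')) i y = p R i x + p R i y"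
    and "p (R(i := ranking (y # x # u') v')) i x + p (R(i := ranking (y # x # u') v')) i y = p R i x + p R i y"
  using sp_eq[of R i "[x, y]" u v "[x, y]" u' v'] sp_eq[of R i "[x, y]" u v "[y, x]" u' v'] assms
  by (simp_all add: insert_commute)

text \<open>With all acceptable objects as the initial segment, their total share is fixed, and
  \<open>row\<close> passes to the complement.\<close>

lemma sp_none:
  assumes "R \<in> profiles" "R i = ranking u v" "distinct u" "distinct u'" "set u' = set u"
  shows "q (R(i := ranking u' v')) i = q R i"
  using sp_eq[of R i u "[]" v u' "[]" v'] row[of R i "set u"] row[of "R(i := ranking u' v')" i "set u"] assms
  by simp

lemma ete:
  assumes "R \<in> profiles" "R i = R j"
  shows "p R i x = p R j x" "q R i = q R j"
proof -
  show *: "p R i x = p R j x" for x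
    using equals assms unfolding equal_treatment_of_equals_def by blast
  show "q R i = q R j"
    using row[of R i UNIV] row[of R j UNIV] assms * by simp
qed

lemma column_pattern:
  assumes "pattern R i w j x k y l z"
  shows "(\<Sum>m\<in>UNIV. p R m t) = p R i t + p R j t + p R k t + p R l t"
proof -
  have "p R m t = 0" if "m \<notin> {i, j, k, l}" for m
    using assms that by (intro p_eq_0) (auto simp: pattern_def)
  then have "(\<Sum>m\<in>UNIV. p R m t) = (\<Sum>m\<in>{i, j, k, l}. p R m t)"
    by (intro sum.mono_neutral_right) auto
  then show ?thesis using assms by (simp add: pattern_def add_ac)
qed

text \<open>Three agents demanding \<open>t\<close> cannot all be served by the other two
  objects.\<close>

lemma column3:
  assumes pat: "pattern R i (ranking u1 v1) j (ranking u2 v2) k (ranking u3 v3) l (ranking u4 v4)"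
    and sub: "set u1 \<union> set u2 \<union> set u3 \<union> set u4 \<subseteq> {a, b, c}" and t: "t \<in> {a, b, c}"
    and len: "3 \<le> length (filter (\<lambda>u. t \<in> set u) [u1, u2, u3, u4])"
  shows "p R i t + p R j t + p R k t + p R l t = 1"
proof -
  \<comment> \<open>Filtering keeps the list of agents distinct, so the length counted on the
    reports becomes the cardinality needed in \<open>column_demand\<close>.\<close>
  define L where "L = filter (\<lambda>m. t \<in> acceptable (R m)) [i, j, k, l]"
  have "length L = length (filter (\<lambda>u. t \<in> set u) [u1, u2, u3, u4])"
    using pat by (simp add: L_def pattern_def)
  moreover have "distinct L"
    using pat unfolding L_def pattern_def by (intro distinct_filter) blast
  ultimately have "3 \<le> card (set L)"
    using len distinct_card[of L] by linarith
  moreover have "card ({a, b, c} - {t}) = 2"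
    using t by auto
  moreover have "\<forall>m\<in>set L. t \<in> acceptable (R m) \<and> acceptable (R m) \<subseteq> insert t ({a, b, c} - {t})"
    using pat sub by (auto simp: L_def pattern_def)
  moreover have "R \<in> profiles"
    using pat by (simp add: pattern_def)
  ultimately have "(\<Sum>i\<in>UNIV. p R i t) = 1"
    by (intro column_demand[where M = "set L" and S = "{a, b, c} - {t}"]) auto
  then show ?thesis using column_pattern[OF pat] by simp
qed

lemma column_pattern_le: "pattern R i w j x k y l z \<Longrightarrow> p R i t + p R j t + p R k t + p R l t \<le> 1"
  using column_le[of R t] column_pattern[of R i w j x k y l z t] by (simp add: pattern_def)

text \<open>The two agents \<open>i\<close> and \<open>j\<close> cannot both be satisfied by
  \<open>s\<close>, the only alternative to \<open>t\<close>.\<close>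

lemma column_twins:
  assumes pat: "pattern R i w j x k y l z"
    and "t \<in> acceptable w" "t \<in> acceptable x" "acceptable w \<subseteq> {t, s}" "acceptable x \<subseteq> {t, s}" "s \<noteq> t"
  shows "p R i t + p R j t + p R k t + p R l t = 1"
proof -
  have "(\<Sum>m\<in>UNIV. p R m t) = 1"
    using assms by (intro column_demand[where M = "{i, j}" and S = "{s}"]) (auto simp: pattern_def)
  then show ?thesis using column_pattern[OF pat] by simp
qed

lemma column_single:
  assumes pat: "pattern R i w j x k y l z" and "acceptable w = {t}"
  shows "p R i t + p R j t + p R k t + p R l t = 1"
proof -
  have "(\<Sum>m\<in>UNIV. p R m t) = 1"
    using assms by (intro column_demand[where M = "{i}" and S = "{}"]) (auto simp: pattern_def)
  then show ?thesis using column_pattern[OF pat] by simp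
qed

lemma margins:
  assumes pat: "pattern R i (ranking u1 v1) j (ranking u2 v2) k (ranking u3 v3) l (ranking u4 v4)"
    and sub: "set u1 \<union> set u2 \<union> set u3 \<union> set u4 \<subseteq> {a, b, c}"
  shows "p R i a + p R i b + p R i c + q R i = 1" "p R j a + p R j b + p R j c + q R j = 1"
        "p R k a + p R k b + p R k c + q R k = 1" "p R l a + p R l b + p R l c + q R l = 1"
        "t \<notin> set u1 \<Longrightarrow> p R i t = 0" "t \<notin> set u2 \<Longrightarrow> p R j t = 0"
        "t \<notin> set u3 \<Longrightarrow> p R k t = 0" "t \<notin> set u4 \<Longrightarrow> p R l t = 0"
  using row[of R i "{a, b, c}"] row[of R j "{a, b, c}"] row[of R k "{a, b, c}"] row[of R l "{a, b, c}"]
    pat sub p_eq_0[of R t i] p_eq_0[of R t j] p_eq_0[of R t k] p_eq_0[of R t l]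
  by (simp_all add: pattern_def add.assoc)

section \<open>Averaging over classes of profiles\<close>

text \<open>
  Strategy-proofness lets every agent of \<open>S\<close> switch to the reference preference \<open>r\<close> without
  affecting its own value of \<open>h\<close>; the agents that already report \<open>r\<close> are equals and split the rest.
\<close>
lemma symmetric_share:
  fixes h :: "('n, 'o) profile \<Rightarrow> 'n \<Rightarrow> real"
  assumes upd: "\<And>R m. R \<in> C \<Longrightarrow> m \<in> S \<Longrightarrow> R(m := r) \<in> C \<and> h (R(m := r)) m = h R m"
    and eq: "\<And>R m m'. R \<in> C \<Longrightarrow> m \<in> S \<Longrightarrow> m' \<in> S \<Longrightarrow> R m = R m' \<Longrightarrow> h R m = h R m'"
    and total: "\<And>R. R \<in> C \<Longrightarrow> (\<Sum>m\<in>S. h R m) = K"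
    and "R \<in> C" "i \<in> S"
  shows "h R i = K / card S"
  using assms(4,5)
proof (induction "card {m \<in> S. R m \<noteq> r}" arbitrary: R i rule: less_induct)
  case (less R i)
  have S: "card S > 0" using less.prems by (simp add: card_gt_0_iff) blast
  \<comment> \<open>Switching such an agent to \<open>r\<close> lowers the induction measure and
    keeps its value of \<open>h\<close>.\<close>
  have other: "h R m = K / card S" if "m \<in> S" "R m \<noteq> r" for m
  proof -
    have "{m' \<in> S. (R(m := r)) m' \<noteq> r} \<subset> {m \<in> S. R m \<noteq> r}" using that by auto
    then have "card {m' \<in> S. (R(m := r)) m' \<noteq> r} < card {m \<in> S. R m \<noteq> r}"
      by (intro psubset_card_mono) auto
    then have "h (R(m := r)) m = K / card S"
      using upd[OF less.prems(1) that(1)] that(1) by (intro less.hyps) auto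
    then show ?thesis using upd[OF less.prems(1) that(1)] by simp
  qed
  show ?case
  proof (cases "R i = r")
    case True
    let ?A = "{m \<in> S. R m = r}"
    \<comment> \<open>All agents not reporting \<open>r\<close> already have the average value, so
      the equals reporting \<open>r\<close> are left with the average as well.\<close>
    have "(\<Sum>m\<in>S. h R m) = (\<Sum>m\<in>?A. h R m) + (\<Sum>m\<in>S - ?A. h R m)"
      by (subst sum.subset_diff[of ?A]) (auto simp: add.commute)
    also have "(\<Sum>m\<in>?A. h R m) = (\<Sum>m\<in>?A. h R i)"
    proof (intro sum.cong refl)
      fix m assume "m \<in> ?A"
      then show "h R m = h R i" using True by (intro eq less.prems) auto
    qed
    also have "(\<Sum>m\<in>S - ?A. h R m) = (\<Sum>m\<in>S - ?A. K / card S)"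
      using other by (intro sum.cong) auto
    finally have "K = card ?A * h R i + real (card (S - ?A)) * (K / card S)"
      using total[OF less.prems(1)] by simp
    moreover have "real (card (S - ?A)) = real (card S) - card ?A"
      by (simp add: card_Diff_subset of_nat_diff card_mono)
    ultimately have "K = card ?A * h R i + (real (card S) - card ?A) * (K / card S)"
      by simp
    moreover have "card S * (K / card S) = K" using S by auto
    ultimately have "card ?A * (h R i - K / card S) = 0"
      by (simp add: algebra_simps)
    moreover have "card ?A \<noteq> 0" using True less.prems(2) by (auto simp: card_eq_0_iff)
    ultimately show ?thesis by (metis mult_eq_0_iff of_nat_eq_0_iff right_minus_eq)
  qed (use other less.prems in simp)
qed

text \<open>The class is that of all profiles in which the four agents report from \<open>L\<close>
  and everybody else accepts nothing.\<close>

lemma symmetric4: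
  fixes h :: "('n, 'o) profile \<Rightarrow> 'n \<Rightarrow> real"
  assumes sp: "\<And>R m. R \<in> profiles \<Longrightarrow> R m \<in> L \<Longrightarrow> h (R(m := r)) m = h R m" and r: "r \<in> L" "r \<in> preferences"
    and eq: "\<And>R m m'. R \<in> profiles \<Longrightarrow> R m = R m' \<Longrightarrow> h R m = h R m'"
    and total: "\<And>R w x y z. pattern R i w j x k y l z \<Longrightarrow> {w, x, y, z} \<subseteq> L \<Longrightarrow> h R i + h R j + h R k + h R l = K"
    and pat: "pattern R i w j x k y l z" "{w, x, y, z} \<subseteq> L" and m: "m \<in> {i, j, k, l}"
  shows "h R m = K / 4"
proof -
  let ?C = "{R. pattern R i (R i) j (R j) k (R k) l (R l) \<and> {R i, R j, R k, R l} \<subseteq> L}"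
  have "h R m = K / card {i, j, k, l}"
  proof (rule symmetric_share[where C = ?C and r = r])
    fix R m assume "R \<in> ?C" "m \<in> {i, j, k, l}"
    then show "R(m := r) \<in> ?C \<and> h (R(m := r)) m = h R m"
      using r sp[of R m] by (auto simp: pattern_def)
  next
    fix R m m' assume "R \<in> ?C" "R m = R m'"
    then show "h R m = h R m'" by (intro eq) (auto simp: pattern_def)
  next
    fix R assume "R \<in> ?C"
    then show "(\<Sum>m\<in>{i, j, k, l}. h R m) = K"
      using total[of R "R i" "R j" "R k" "R l"] by (simp add: pattern_def)
  qed (use pat m in \<open>simp_all add: pattern_def\<close>)
  then show ?thesis using pat by (simp add: pattern_def)
qed

text \<open>Agent \<open>l\<close> keeps the report \<open>z\<close> throughout; only the other
  three agents are averaged.\<close>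

lemma symmetric3:
  fixes h :: "('n, 'o) profile \<Rightarrow> 'n \<Rightarrow> real"
  assumes sp: "\<And>R m. R \<in> profiles \<Longrightarrow> R m \<in> L \<Longrightarrow> h (R(m := r)) m = h R m" and r: "r \<in> L" "r \<in> preferences"
    and eq: "\<And>R m m'. R \<in> profiles \<Longrightarrow> R m = R m' \<Longrightarrow> h R m = h R m'"
    and total: "\<And>R w x y. pattern R i w j x k y l z \<Longrightarrow> {w, x, y} \<subseteq> L \<Longrightarrow> h R i + h R j + h R k = K"
    and pat: "pattern R i w j x k y l z" "{w, x, y} \<subseteq> L" and m: "m \<in> {i, j, k}"
  shows "h R m = K / 3"
proof -
  let ?C = "{R. pattern R i (R i) j (R j) k (R k) l z \<and> {R i, R j, R k} \<subseteq> L}"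
  have "h R m = K / card {i, j, k}"
  proof (rule symmetric_share[where C = ?C and r = r])
    fix R m assume "R \<in> ?C" "m \<in> {i, j, k}"
    then show "R(m := r) \<in> ?C \<and> h (R(m := r)) m = h R m"
      using r sp[of R m] by (auto simp: pattern_def)
  next
    fix R m m' assume "R \<in> ?C" "R m = R m'"
    then show "h R m = h R m'" by (intro eq) (auto simp: pattern_def)
  next
    fix R assume "R \<in> ?C"
    then show "(\<Sum>m\<in>{i, j, k}. h R m) = K"
      using total[of R "R i" "R j" "R k"] by (simp add: pattern_def)
  qed (use pat m in \<open>simp_all add: pattern_def\<close>)
  then show ?thesis using pat by (simp add: pattern_def)
qed

section \<open>Shares at symmetric profiles\<close>

text \<open>
  Below, a lemma named after four preferences concerns the profiles in which \<open>i, j, k, l\<close> report them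
  in this order; \<open>p R i x\<close> is the probability that \<open>i\<close> receives \<open>x\<close> and \<open>q R i\<close> that \<open>i\<close> is unassigned.
\<close>

abbreviation "ab \<equiv> ranking [a, b] [c]"
abbreviation "ac \<equiv> ranking [a, c] [b]"
abbreviation "abc \<equiv> ranking [a, b, c] []"
abbreviation "acb \<equiv> ranking [a, c, b] []"
abbreviation "bac \<equiv> ranking [b, a, c] []"
abbreviation "ba \<equiv> ranking [b, a] [c]"
abbreviation "bc \<equiv> ranking [b, c] [a]"
abbreviation "ca \<equiv> ranking [c, a] [b]"
abbreviation "cb \<equiv> ranking [c, b] [a]"

text \<open>The bound on \<open>u\<close> confines demand to three objects, as
  \<open>column3\<close> requires.\<close>

definition tops :: "'o \<Rightarrow> 'o pref set" where
  "tops t = {ranking (t # u) v |u v. set u \<subseteq> {a, b, c}}"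

definition full :: "'o pref set" where
  "full = {ranking u v |u v. distinct u \<and> set u = {a, b, c}}"

lemma topsI [simp, intro]: "set u \<subseteq> {a, b, c} \<Longrightarrow> ranking (t # u) v \<in> tops t"
  unfolding tops_def by blast

lemma fullI [simp, intro]: "distinct u \<Longrightarrow> set u = {a, b, c} \<Longrightarrow> ranking u v \<in> full"
  unfolding full_def by blast

lemma topsE:
  assumes "r \<in> tops t"
  obtains u v where "r = ranking (t # u) v" "set u \<subseteq> {a, b, c}"
  using assms unfolding tops_def by blast

lemma fullE:
  assumes "r \<in> full"
  obtains u v where "r = ranking u v" "distinct u" "set u = {a, b, c}"
  using assms unfolding full_def by blast

text \<open>By \<open>sp1\<close> the share of the top object is unaffected by the rest of the
  agent's own report, and \<open>t\<close> is always assigned, so the total to be split is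
  1.\<close>

lemma all_top:
  assumes pat: "pattern R i w j x k y l z" and top: "{w, x, y, z} \<subseteq> tops t"
    and t: "t \<in> {a, b, c}" and m: "m \<in> {i, j, k, l}"
  shows "p R m t = 1 / 4"
proof (rule symmetric4[where L = "tops t" and r = "ranking [t] []", OF _ _ _ _ _ pat top m])
  fix R :: "('n, 'o) profile" and m assume "R \<in> profiles" "R m \<in> tops t"
  then show "p (R(m := ranking [t] [])) m t = p R m t" by (metis sp1 topsE)
next
  fix R w x y z assume pat: "pattern R i w j x k y l z" and top: "{w, x, y, z} \<subseteq> tops t"
  obtain u1 v1 where 1: "w = ranking (t # u1) v1" "set u1 \<subseteq> {a, b, c}" using top by (auto elim: topsE)
  obtain u2 v2 where 2: "x = ranking (t # u2) v2" "set u2 \<subseteq> {a, b, c}" using top by (auto elim: topsE)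
  obtain u3 v3 where 3: "y = ranking (t # u3) v3" "set u3 \<subseteq> {a, b, c}" using top by (auto elim: topsE)
  obtain u4 v4 where 4: "z = ranking (t # u4) v4" "set u4 \<subseteq> {a, b, c}" using top by (auto elim: topsE)
  show "p R i t + p R j t + p R k t + p R l t = 1"
    by (rule column3[OF pat[unfolded 1 2 3 4]]) (use 1 2 3 4 t in auto)
qed (auto intro: ete)

lemma full_members [simp]: "abc \<in> full" "acb \<in> full" "bac \<in> full"
  by (auto intro!: fullI)

text \<open>Reordering a full list keeps the agent's own unassigned probability. All three objects
  are assigned among four agents, so exactly one agent is left out on average.\<close>

lemma all_full:
  assumes pat: "pattern R i w j x k y l z" and fl: "{w, x, y, z} \<subseteq> full" and m: "m \<in> {i, j, k, l}"
  shows "q R m = 1 / 4"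
proof (rule symmetric4[where L = full and r = abc, OF _ _ _ _ _ pat fl m])
  fix R :: "('n, 'o) profile" and m assume "R \<in> profiles" "R m \<in> full"
  then show "q (R(m := abc)) m = q R m" by (auto intro!: sp_none elim!: fullE)
next
  fix R w x y z assume pat: "pattern R i w j x k y l z" and fl: "{w, x, y, z} \<subseteq> full"
  obtain u1 v1 where 1: "w = ranking u1 v1" "set u1 = {a, b, c}" using fl by (auto elim: fullE)
  obtain u2 v2 where 2: "x = ranking u2 v2" "set u2 = {a, b, c}" using fl by (auto elim: fullE)
  obtain u3 v3 where 3: "y = ranking u3 v3" "set u3 = {a, b, c}" using fl by (auto elim: fullE)
  obtain u4 v4 where 4: "z = ranking u4 v4" "set u4 = {a, b, c}" using fl by (auto elim: fullE)
  note pat' = pat[unfolded 1 2 3 4]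
  have col: "p R i t + p R j t + p R k t + p R l t = 1" if "t \<in> {a, b, c}" for t
    by (rule column3[OF pat']) (use 1 2 3 4 that in auto)
  have "set u1 \<union> set u2 \<union> set u3 \<union> set u4 \<subseteq> {a, b, c}" using 1 2 3 4 by simp
  from margins(1-4)[OF pat' this] show "q R i + q R j + q R k + q R l = 1"
    using col[of a] col[of b] col[of c] by simp
qed (auto intro: ete)

text \<open>All these reports have \<open>a\<close> and \<open>b\<close> as their first two objects,
  and both objects are always assigned, so a total of 2 is split among four agents.\<close>

lemma pair_total:
  assumes pat: "pattern R i w j x k y l z" and sub: "{w, x, y, z} \<subseteq> {ab, abc, bac}" and m: "m \<in> {i, j, k, l}"
  shows "p R m a + p R m b = 1 / 2"
proof -
  have "p R m a + p R m b = 2 / 4"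
  proof (rule symmetric4[where L = "{ab, abc, bac}" and r = ab, OF _ _ _ _ _ pat sub m])
    fix R :: "('n, 'o) profile" and m assume "R \<in> profiles" "R m \<in> {ab, abc, bac}"
    then show "p (R(m := ab)) m a + p (R(m := ab)) m b = p R m a + p R m b"
      using sp2(1)[of R m a b "[]" "[c]" "[]" "[c]"] sp2(1)[of R m a b "[c]" "[]" "[]" "[c]"]
        sp2(2)[of R m b a "[c]" "[]" "[]" "[c]"]
      by (auto simp del: fun_upd_apply)
  next
    fix R w x y z assume pat: "pattern R i w j x k y l z" and sub: "{w, x, y, z} \<subseteq> {ab, abc, bac}"
    have ex: "\<exists>u v. r = ranking u v \<and> {a, b} \<subseteq> set u \<and> set u \<subseteq> {a, b, c}" if "r \<in> {ab, abc, bac}" for r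
      using that by auto
    obtain u1 v1 where 1: "w = ranking u1 v1" "{a, b} \<subseteq> set u1" "set u1 \<subseteq> {a, b, c}" using ex[of w] sub by auto
    obtain u2 v2 where 2: "x = ranking u2 v2" "{a, b} \<subseteq> set u2" "set u2 \<subseteq> {a, b, c}" using ex[of x] sub by auto
    obtain u3 v3 where 3: "y = ranking u3 v3" "{a, b} \<subseteq> set u3" "set u3 \<subseteq> {a, b, c}" using ex[of y] sub by auto
    obtain u4 v4 where 4: "z = ranking u4 v4" "{a, b} \<subseteq> set u4" "set u4 \<subseteq> {a, b, c}" using ex[of z] sub by auto
    have "p R i t + p R j t + p R k t + p R l t = 1" if "t \<in> {a, b}" for t
      by (rule column3[OF pat[unfolded 1 2 3 4]]) (use 1 2 3 4 that in auto)
    from this[of a] this[of b]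
    show "p R i a + p R i b + (p R j a + p R j b) + (p R k a + p R k b) + (p R l a + p R l b) = 2"
      by simp
  next
    fix R :: "('n, 'o) profile" and m m' assume "R \<in> profiles" "R m = R m'"
    then show "p R m a + p R m b = p R m' a + p R m' b"
      using ete(1)[of R m m' a] ete(1)[of R m m' b] by simp
  qed auto
  then show ?thesis by simp
qed

text \<open>\<open>pair_total\<close> settles \<open>l\<close>; the unassigned probabilities sum to
  1, and three equals split the other half.\<close>

lemma abc_abc_abc_ab:
  assumes pat: "pattern R i abc j abc k abc l ab"
  shows "q R i = 1 / 6" "q R j = 1 / 6" "q R k = 1 / 6" "q R l = 1 / 2"
proof -
  have "q R i = q R j" "q R i = q R k"
    using ete(2)[of R] pat by (auto simp: pattern_def)
  moreover have "q R l = 1 / 2"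
    using pair_total[OF pat, of l] margins(4)[OF pat] margins(8)[OF pat, of c] by simp
  moreover have "q R i + q R j + q R k + q R l = 1"
    using column3[OF pat, of a] column3[OF pat, of b] column3[OF pat, of c] margins(1-4)[OF pat] by simp
  ultimately show "q R i = 1 / 6" "q R j = 1 / 6" "q R k = 1 / 6" "q R l = 1 / 2" by linarith+
qed

end

section \<open>Consequences of a vanishing share\<close>

text \<open>The vanishing share is assumed here because the two parts of the theorem derive it
  differently. It is demanded for every triple of objects so that the locale can be interpreted
  again with \<open>b\<close> and \<open>c\<close> exchanged.\<close>

locale no_trade_mechanism = fair_mechanism f a b c
  for f :: "('n::finite, 'o::finite) mech" and a b c +
  assumes no_trade: "\<And>(a :: 'o) b c R i w j x k y l. distinct [a, b, c] \<Longrightarrow>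
     {w, x, y} \<subseteq> {ranking [a, b] [c], ranking [a, b, c] []} \<Longrightarrow>
     pattern R i w j x k y l (ranking [a, c, b] []) \<Longrightarrow> p R l b = 0"
begin

lemma no_trade_b:
  assumes pat: "pattern R i w j x k y l z" and "{w, x, y} \<subseteq> {ab, abc}" "z \<in> {acb, ac}"
  shows "p R l b = 0"
proof (cases "z = acb")
  case True
  then show ?thesis using no_trade[of a b c] distinct_objects assms by blast
next
  case False
  then show ?thesis using assms p_eq_0[of R b l] by (auto simp: pattern_def)
qed

text \<open>The objects \<open>a\<close> and \<open>b\<close> are fully assigned, and
  \<open>l\<close> takes 1/4 of \<open>a\<close> and nothing of \<open>b\<close>. The remaining 7/4
  is split among three agents, each of whom has 1/4 of \<open>a\<close>.\<close>

lemma three_top: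
  assumes pat: "pattern R i w j x k y l z" and sub: "{w, x, y} \<subseteq> {ab, abc}" and z: "z \<in> {acb, ac}"
  shows "p R i a = 1 / 4" "p R j a = 1 / 4" "p R k a = 1 / 4" "p R l a = 1 / 4" "p R l b = 0"
    "p R i b = 1 / 3" "p R j b = 1 / 3" "p R k b = 1 / 3"
proof -
  have top: "p R m a = 1 / 4"
    if pat: "pattern R i w j x k y l z" and sub: "{w, x, y} \<subseteq> {ab, abc}" and m: "m \<in> {i, j, k, l}" for R w x y m
    by (rule all_top[OF pat _ _ m]) (use sub z in auto)
  have "p R m a + p R m b = (7 / 4) / 3" if m: "m \<in> {i, j, k}" for m
  proof (rule symmetric3[where L = "{ab, abc}" and r = ab, OF _ _ _ _ _ pat sub m])
    fix R :: "('n, 'o) profile" and m assume "R \<in> profiles" "R m \<in> {ab, abc}"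
    then show "p (R(m := ab)) m a + p (R(m := ab)) m b = p R m a + p R m b"
      by (auto intro!: sp2(1) simp del: fun_upd_apply)
  next
    fix R w x y assume pat: "pattern R i w j x k y l z" and sub: "{w, x, y} \<subseteq> {ab, abc}"
    have ex: "\<exists>u v. r = ranking (a # b # u) v \<and> set u \<subseteq> {c}" if "r \<in> {ab, abc}" for r
      using that by auto
    obtain u1 v1 where 1: "w = ranking (a # b # u1) v1" "set u1 \<subseteq> {c}" using ex[of w] sub by auto
    obtain u2 v2 where 2: "x = ranking (a # b # u2) v2" "set u2 \<subseteq> {c}" using ex[of x] sub by auto
    obtain u3 v3 where 3: "y = ranking (a # b # u3) v3" "set u3 \<subseteq> {c}" using ex[of y] sub by auto
    obtain u4 v4 where 4: "z = ranking u4 v4" "set u4 \<subseteq> {a, b, c}" using z by auto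
    have "p R i b + p R j b + p R k b + p R l b = 1"
      by (rule column3[OF pat[unfolded 1 2 3 4]]) (use 1 2 3 4 in auto)
    then show "p R i a + p R i b + (p R j a + p R j b) + (p R k a + p R k b) = 7 / 4"
      using top[OF pat sub] no_trade_b[OF pat sub z] by simp
  next
    fix R :: "('n, 'o) profile" and m m' assume "R \<in> profiles" "R m = R m'"
    then show "p R m a + p R m b = p R m' a + p R m' b"
      using ete(1)[of R m m' a] ete(1)[of R m m' b] by simp
  qed auto
  from this[of i] this[of j] this[of k]
  show "p R i a = 1 / 4" "p R j a = 1 / 4" "p R k a = 1 / 4" "p R l a = 1 / 4" "p R l b = 0"
    "p R i b = 1 / 3" "p R j b = 1 / 3" "p R k b = 1 / 3"
    using top[OF pat sub, of i] top[OF pat sub, of j] top[OF pat sub, of k] top[OF pat sub, of l]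
      no_trade_b[OF assms] by simp_all
qed

lemma abc_abc_ab_acb:
  assumes pat: "pattern R i abc j abc k ab l acb"
  shows "q R l = 1 / 6"
proof -
  let ?R = "R(l := abc)"
  have "pattern ?R i abc j abc l abc k ab"
    using pat by (auto simp: pattern_def)
  then have "q ?R l = 1 / 6" by (rule abc_abc_abc_ab)
  then show ?thesis
    using sp_none[of R l "[a, c, b]" "[]" "[a, b, c]" "[]"] pat
    by (simp add: pattern_def insert_commute)
qed

text \<open>Under \<open>acb\<close> agent \<open>l\<close> never gets \<open>b\<close>, so the
  share of its first two objects is already everything it receives, and this share survives dropping
  \<open>b\<close>.\<close>

lemma abc_abc_ab_ac:
  assumes pat: "pattern R i abc j abc k ab l ac"
  shows "q R l = 1 / 6"
proof -
  let ?R = "R(l := acb)"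
  have pat': "pattern ?R i abc j abc k ab l acb"
    using pat by (auto simp: pattern_def)
  then have "q ?R l = 1 / 6" by (rule abc_abc_ab_acb)
  moreover have "p ?R l b = 0"
    using no_trade_b[OF pat'] by simp
  moreover have "p ?R l a + p ?R l c = p R l a + p R l c"
    by (rule sp2) (use pat in \<open>auto simp: pattern_def\<close>)
  ultimately show ?thesis
    using margins(4)[OF pat] margins(8)[OF pat, of b] margins(4)[OF pat'] by simp
qed

text \<open>Agent \<open>k\<close> misses out with probability 1 - 1/4 - 1/3 and \<open>l\<close>
  with 1/6; the equals \<open>i\<close> and \<open>j\<close> split the rest of the total 1.\<close>

lemma abc_abc_ab_none:
  assumes pat: "pattern R i abc j abc k ab l z" and z: "z \<in> {acb, ac}"
  shows "q R i = 5 / 24" "q R j = 5 / 24" "q R k = 5 / 12" "q R l = 1 / 6"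
proof -
  obtain u v where u: "z = ranking (a # c # u) v" "set u \<subseteq> {b}"
    using z by auto
  then have sub: "set u \<subseteq> {a, b, c}" by auto
  note pat' = pat[unfolded u]
  have "q R i = q R j"
    using ete(2)[of R] pat by (auto simp: pattern_def)
  moreover have l: "q R l = 1 / 6"
    using pat z abc_abc_ab_acb abc_abc_ab_ac by blast
  moreover have k: "q R k = 5 / 12"
    using three_top[OF pat] margins(3)[OF pat'] margins(7)[OF pat', of c] sub z by simp
  moreover have "q R i + q R j + q R k + q R l = 1"
    using column3[OF pat', of a] column3[OF pat', of b] column3[OF pat', of c] margins(1-4)[OF pat'] sub
    by simp
  ultimately show "q R i = 5 / 24" "q R j = 5 / 24" "q R k = 5 / 12" "q R l = 1 / 6" by linarith+
qed

text \<open>If \<open>i\<close> reports \<open>abc\<close> instead, it gets no \<open>c\<close> by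
  the exchanged form of no trade, hence 3/4 from \<open>a\<close> and \<open>b\<close> together.
  This total survives dropping \<open>c\<close>, and the other three agents are equals.\<close>

lemma ab_acb_acb_acb:
  assumes pat: "pattern R i ab j acb k acb l acb"
  shows "p R i b = 1 / 2" "p R l c = 1 / 3" "q R i = 1 / 4" "q R j = 1 / 4" "q R k = 1 / 4" "q R l = 1 / 4"
proof -
  interpret dual: no_trade_mechanism f a c b
    using mechanism strategy_proof equals non_wasteful no_trade by unfold_locales simp_all
  let ?R = "R(i := abc)"
  have pat': "pattern ?R j acb k acb l acb i abc"
    using pat by (auto simp: pattern_def)
  have "p ?R i a = 1 / 4" "p ?R i c = 0" "q ?R i = 1 / 4"
    using dual.three_top[OF pat'] all_full[OF pat', of i] by auto
  then have "p ?R i a + p ?R i b = 3 / 4"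
    using margins(4)[OF pat'] by simp
  moreover have "p ?R i a + p ?R i b = p R i a + p R i b"
    by (rule sp2) (use pat in \<open>auto simp: pattern_def\<close>)
  moreover have "p R i a = 1 / 4"
    by (rule all_top[OF pat]) auto
  ultimately have "p R i b = 1 / 2" "q R i = 1 / 4"
    using margins(1)[OF pat] margins(5)[OF pat, of c] by auto
  moreover have "q R j = q R l" "q R k = q R l" "p R j c = p R l c" "p R k c = p R l c"
    using ete[of R] pat by (auto simp: pattern_def)
  moreover have "q R i + q R j + q R k + q R l = 1"
    using column3[OF pat, of a] column3[OF pat, of b] column3[OF pat, of c] margins(1-4)[OF pat]
    by auto
  ultimately show "p R i b = 1 / 2" "p R l c = 1 / 3" "q R i = 1 / 4" "q R j = 1 / 4" "q R k = 1 / 4" "q R l = 1 / 4"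
    using column3[OF pat, of c] margins(5)[OF pat, of c] by auto
qed

section \<open>Bounds leading to the wasteful profile\<close>

abbreviation "bca \<equiv> ranking [b, c, a] []"

text \<open>The value 5/12 carries over from \<open>abc\<close> to \<open>ab\<close>, so
  \<open>i\<close> and \<open>j\<close> take 5/6 of \<open>b\<close> and leave 1/12 to each of
  \<open>k\<close> and \<open>l\<close>. As \<open>l\<close> gets at most half of \<open>c\<close>,
  at least 1 - 1/4 - 1/12 - 1/2 remains.\<close>

lemma ab_ab_acb_acb:
  assumes b: "\<And>R. pattern R i ab j abc k acb l acb \<Longrightarrow> p R j b = 5 / 12"
    and pat: "pattern R i ab j ab k acb l acb"
  shows "1 / 6 \<le> q R l"
proof -
  let ?R = "R(j := abc)"
  have pat': "pattern ?R i ab j abc k acb l acb"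
    using pat by (auto simp: pattern_def)
  have "p ?R j a + p ?R j b = p R j a + p R j b"
    by (rule sp2) (use pat in \<open>auto simp: pattern_def\<close>)
  moreover have "p ?R j a = 1 / 4" "p R j a = 1 / 4" "p R l a = 1 / 4"
    using all_top[OF pat', of a j] all_top[OF pat, of a j] all_top[OF pat, of a l] by auto
  moreover have "p R i b = p R j b" "p R k b = p R l b" "p R k c = p R l c"
    using ete[of R] pat by (auto simp: pattern_def)
  ultimately have "p R l b = 1 / 12"
    using b[OF pat'] column3[OF pat, of b] by simp
  moreover have "p R l c \<le> 1 / 2"
    using column_pattern_le[OF pat, of c] share_nonneg[of "f R" i "Some c"] share_nonneg[of "f R" j "Some c"]
      \<open>p R k c = p R l c\<close> by simp
  ultimately show ?thesis
    using margins(4)[OF pat] \<open>p R l a = 1 / 4\<close> by simp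
qed

text \<open>Reporting \<open>a\<close> alone would give \<open>j\<close> this object for sure, so
  \<open>j\<close> also gets it under \<open>ab\<close> and leaves \<open>b\<close> to three
  equals.\<close>

lemma bc_ab_bc_bc:
  assumes pat: "pattern R i bc j ab k bc l bc"
  shows "p R i b = 1 / 3"
proof -
  let ?R = "R(j := ranking [a] [b, c])"
  have pat': "pattern ?R j (ranking [a] [b, c]) i bc k bc l bc"
    using pat by (auto simp: pattern_def)
  have "p ?R j a = 1"
    using column_single[OF pat', of a] margins(6,7,8)[OF pat', of a] by simp
  moreover have "p ?R j a = p R j a"
    by (rule sp1) (use pat in \<open>auto simp: pattern_def\<close>)
  ultimately have "p R j b = 0"
    using margins(2)[OF pat] share_nonneg[of "f R" j "Some b"] share_nonneg[of "f R" j "Some c"]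
      share_nonneg[of "f R" j None] by simp
  moreover have "p R i b = p R k b" "p R i b = p R l b"
    using ete[of R] pat by (auto simp: pattern_def)
  ultimately show ?thesis using column3[OF pat, of b] by simp
qed

lemma ba_ba_bc_bc:
  assumes pat: "pattern R i ba j ba k bc l bc"
  shows "p R j a + p R j b = 3 / 4"
proof -
  have "p R j b = 1 / 4"
    by (rule all_top[OF pat]) auto
  moreover have "p R i a = p R j a"
    using ete[of R] pat by (auto simp: pattern_def)
  ultimately show ?thesis
    using column_twins[OF pat, of a b] margins(7,8)[OF pat, of a] by simp
qed

text \<open>The 1/3 of \<open>b\<close> comes from switching \<open>i\<close> to \<open>bc\<close>.
  The 1/4 of \<open>a\<close> is what \<open>j\<close> must leave, since under \<open>ba\<close> it
  would get only 3/4 from both objects.\<close>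

lemma ba_ab_bc_bc:
  assumes pat: "pattern R i ba j ab k bc l bc"
  shows "7 / 12 \<le> p R i a + p R i b"
proof -
  let ?R = "R(i := bc)" let ?R' = "R(j := ba)"
  have pat1: "pattern ?R i bc j ab k bc l bc" and pat2: "pattern ?R' i ba j ba k bc l bc"
    using pat by (auto simp: pattern_def)
  have "p ?R i b = p R i b"
    by (rule sp1) (use pat in \<open>auto simp: pattern_def\<close>)
  then have "p R i b = 1 / 3"
    using bc_ab_bc_bc[OF pat1] by simp
  moreover have "p ?R' j a + p ?R' j b = p R j a + p R j b"
    by (rule sp2) (use pat in \<open>auto simp: pattern_def\<close>)
  then have "p R j a \<le> 3 / 4"
    using ba_ba_bc_bc[OF pat2] share_nonneg[of "f R" j "Some b"] by simp
  then have "1 / 4 \<le> p R i a"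
    using column_twins[OF pat, of a b] margins(7,8)[OF pat, of a] by simp
  ultimately show ?thesis by simp
qed

text \<open>Reporting \<open>ba\<close> would secure 7/12 for \<open>i\<close>, of which
  \<open>a\<close> contributes only 1/2 here. So \<open>i\<close> and \<open>j\<close> take at least
  1/12 of \<open>b\<close> each, leaving at most 5/12 of \<open>b\<close> and 1/2 of
  \<open>c\<close> to each of \<open>k\<close> and \<open>l\<close>.\<close>

lemma ab_ab_bc_bc:
  assumes pat: "pattern R i ab j ab k bc l bc"
  shows "p R k b + p R k c \<le> 11 / 12"
proof -
  let ?R = "R(i := ba)"
  have pat': "pattern ?R i ba j ab k bc l bc"
    using pat by (auto simp: pattern_def)
  have "p ?R i a + p ?R i b = p R i a + p R i b"
    by (rule sp2) (use pat in \<open>auto simp: pattern_def\<close>)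
  moreover have eq: "p R i t = p R j t" "p R k t = p R l t" for t
    using ete[of R] pat by (auto simp: pattern_def)
  moreover have "p R i a = 1 / 2"
    using column_twins[OF pat, of a b] margins(7,8)[OF pat, of a] eq(1)[of a] by simp
  ultimately have "1 / 12 \<le> p R i b"
    using ba_ab_bc_bc[OF pat'] by simp
  then have "p R k b \<le> 5 / 12"
    using column3[OF pat, of b] eq(1)[of b] eq(2)[of b] by simp
  moreover have "p R k c \<le> 1 / 2"
    using column_pattern_le[OF pat, of c] share_nonneg[of "f R" i "Some c"] share_nonneg[of "f R" j "Some c"]
      eq(2)[of c] by simp
  ultimately show ?thesis by simp
qed

text \<open>The three assumptions are the facts about neighbouring profiles whose proofs differ
  between the two parts of the theorem.\<close>

lemma ab_ab_acb_bc:
  assumes none: "\<And>R. pattern R i ab j ab k acb l acb \<Longrightarrow> 1 / 6 \<le> q R l"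
    and l: "\<And>R. pattern R i ab j ab k acb l ba \<Longrightarrow> p R l a = 0"
    and k: "\<And>R. pattern R i ab j ab k ca l bc \<Longrightarrow> p R k a = 0"
    and pat: "pattern R i ab j ab k acb l bc"
  shows "1 / 6 \<le> q R l" "p R k c + p R l c \<le> 5 / 6"
proof -
  \<comment> \<open>Reordering \<open>acb\<close> to \<open>bca\<close> keeps the unassigned
    probability of \<open>l\<close>; dropping \<open>a\<close> can then only increase it.\<close>
  let ?R1 = "R(l := bca)" and ?R2 = "R(l := acb)"
  have pat1: "pattern ?R1 i ab j ab k acb l bca" and pat2: "pattern ?R2 i ab j ab k acb l acb"
    using pat by (auto simp: pattern_def)
  have "q (?R1(l := acb)) l = q ?R1 l"
    by (rule sp_none) (use pat1 in \<open>auto simp: pattern_def\<close>)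
  then have "1 / 6 \<le> q ?R1 l"
    using none[OF pat2] by simp
  moreover have "p ?R1 l b + p ?R1 l c = p R l b + p R l c"
    by (rule sp2) (use pat in \<open>auto simp: pattern_def\<close>)
  ultimately show q: "1 / 6 \<le> q R l"
    using margins(4)[OF pat] margins(4)[OF pat1] margins(8)[OF pat, of a] share_nonneg[of "f ?R1" l "Some a"]
    by simp
  \<comment> \<open>If \<open>k\<close> reports \<open>ab\<close>, three equals split
    \<open>a\<close>, which \<open>l\<close> does not accept.\<close>
  have ka: "p R k a = 1 / 3"
  proof -
    let ?R = "R(k := ab)"
    have pat': "pattern ?R i ab j ab k ab l bc"
      using pat by (auto simp: pattern_def)
    have "p ?R k a = p R k a"
      by (rule sp1) (use pat in \<open>auto simp: pattern_def\<close>)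
    moreover have "p ?R i a = p ?R k a" "p ?R j a = p ?R k a"
      using ete[of ?R] pat' unfolding pattern_def by metis+
    ultimately show ?thesis
      using column3[OF pat', of a] margins(8)[OF pat', of a] by simp
  qed
  \<comment> \<open>Under \<open>ba\<close> agent \<open>l\<close> gets no \<open>a\<close>, so its
    share of \<open>b\<close> is the whole 1/4 + 1/3 obtained under \<open>ab\<close>.\<close>
  have lb: "p R l b = 7 / 12"
  proof -
    let ?R = "R(l := ba)" and ?R' = "R(l := ab)"
    have pat': "pattern ?R i ab j ab k acb l ba" and pat'': "pattern ?R' i ab j ab l ab k acb"
      using pat by (auto simp: pattern_def)
    have "p (?R(l := ab)) l b + p (?R(l := ab)) l a = p ?R l b + p ?R l a"
      by (rule sp2) (use pat' in \<open>auto simp: pattern_def\<close>)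
    moreover have "p ?R' l a = 1 / 4" "p ?R' l b = 1 / 3"
      using three_top[OF pat''] by auto
    moreover have "p ?R l b = p R l b"
      by (rule sp1) (use pat in \<open>auto simp: pattern_def\<close>)
    ultimately show ?thesis
      using l[OF pat'] by simp
  qed
  \<comment> \<open>The chain \<open>acb\<close>, \<open>ca\<close>, \<open>cb\<close>,
    \<open>bc\<close> for \<open>k\<close>: under \<open>ca\<close> its total is all in
    \<open>c\<close>, which is its top object there and under \<open>cb\<close>.\<close>
  have "p R k a + p R k c \<le> 11 / 12"
  proof -
    let ?R = "R(k := ca)" and ?R1 = "R(k := cb)" and ?R2 = "R(k := bc)"
    have pat': "pattern ?R i ab j ab k ca l bc" and pat1: "pattern ?R1 i ab j ab k cb l bc"
      and pat2: "pattern ?R2 i ab j ab k bc l bc"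
      using pat by (auto simp: pattern_def)
    have "p ?R k a + p ?R k c = p R k a + p R k c"
      by (rule sp2) (use pat in \<open>auto simp: pattern_def\<close>)
    moreover have "p (?R(k := cb)) k c = p ?R k c"
      by (rule sp1) (use pat' in \<open>auto simp: pattern_def\<close>)
    moreover have "p (?R1(k := bc)) k c + p (?R1(k := bc)) k b = p ?R1 k c + p ?R1 k b"
      by (rule sp2) (use pat1 in \<open>auto simp: pattern_def\<close>)
    ultimately show ?thesis
      using k[OF pat'] ab_ab_bc_bc[OF pat2] share_nonneg[of "f ?R1" k "Some b"] by simp
  qed
  \<comment> \<open>Agent \<open>k\<close> has at most 11/12 - 1/3 of \<open>c\<close>, and
    \<open>l\<close> at most 1 - 1/6 - 7/12.\<close>
  then show "p R k c + p R l c \<le> 5 / 6"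
    using ka lb q margins(4)[OF pat] margins(8)[OF pat, of a] by simp
qed

end

section \<open>Equal treatment of almost equals\<close>

text \<open>Almost equality covers only acceptable objects; shares of unacceptable ones are 0 for
  both agents.\<close>

lemma (in non_wasteful_mechanism) almost_equals_imp_equals:
  assumes "equal_treatment_of_almost_equals f"
  shows "equal_treatment_of_equals f"
  unfolding equal_treatment_of_equals_def
proof (intro ballI allI impI)
  fix R :: "('n, 'o) profile" and i j x assume R: "R \<in> profiles" "R i = R j"
  show "p R i x = p R j x"
  proof (cases "x \<in> acceptable (R i)")
    case True
    then show ?thesis using assms R unfolding equal_treatment_of_almost_equals_def by simp
  next
    case False
    then show ?thesis using R p_eq_0[of R x i] p_eq_0[of R x j] by simp
  qed
qed

locale almost_fair_mechanism = fair_mechanism f a b c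
  for f :: "('n::finite, 'o::finite) mech" and a b c +
  assumes almost_equals: "equal_treatment_of_almost_equals f"
begin

text \<open>The object \<open>x\<close> is the best unacceptable one for \<open>m\<close> and the
  worst acceptable one for \<open>m'\<close>, so the two agents are almost equals.\<close>

lemma etae:
  assumes "R \<in> profiles" "R m = ranking u (x # v)" "R m' = ranking (u @ [x]) v" "x \<notin> set u" "y \<in> set u"
  shows "p R m y = p R m' y"
proof -
  have "card (insert x (set u)) = Suc (card (set u))"
    using assms(4) by simp
  moreover have "restrict_objects (R m) = restrict_objects (R m')"
    using assms(2,3) by (simp add: restrict_objects_ranking)
  ultimately show ?thesis
    using almost_equals assms unfolding equal_treatment_of_almost_equals_def by simp
qed

lemma etae_cases:
  assumes "R \<in> profiles" "R m \<in> {ranking u (x # v), ranking (u @ [x]) v}"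
    "R m' \<in> {ranking u (x # v), ranking (u @ [x]) v}" "x \<notin> set u" "y \<in> set u"
  shows "p R m y = p R m' y"
proof (cases "R m = R m'")
  case True
  then show ?thesis using ete assms(1) by blast
next
  case False
  then show ?thesis
    using etae[of R m u x v m' y] etae[of R m' u x v m y] assms by auto
qed

text \<open>A stronger form of averaging: values agree across different reports within
  \<open>S\<close>, so the value at the uniform profile spreads over the class, one switch at a
  time, without knowing any total.\<close>

lemma almost_symmetric_share:
  fixes h :: "('n, 'o) profile \<Rightarrow> 'n \<Rightarrow> real"
  assumes upd: "\<And>R m. R \<in> C \<Longrightarrow> m \<in> S \<Longrightarrow> R(m := r) \<in> C \<and> h (R(m := r)) m = h R m"
    and eq: "\<And>R m m'. R \<in> C \<Longrightarrow> m \<in> S \<Longrightarrow> m' \<in> S \<Longrightarrow> h R m = h R m'"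
    and base: "\<And>R m. R \<in> C \<Longrightarrow> \<forall>m\<in>S. R m = r \<Longrightarrow> m \<in> S \<Longrightarrow> h R m = K"
    and "R \<in> C" "i \<in> S"
  shows "h R i = K"
  using assms(4,5)
proof (induction "card {m \<in> S. R m \<noteq> r}" arbitrary: R i rule: less_induct)
  case (less R i)
  show ?case
  proof (cases "\<forall>m\<in>S. R m = r")
    case True
    then show ?thesis using base less.prems by blast
  next
    case False
    then obtain m where m: "m \<in> S" "R m \<noteq> r" by blast
    then have "{m' \<in> S. (R(m := r)) m' \<noteq> r} \<subset> {m \<in> S. R m \<noteq> r}" by auto
    then have "card {m' \<in> S. (R(m := r)) m' \<noteq> r} < card {m \<in> S. R m \<noteq> r}"
      by (intro psubset_card_mono) auto
    then have "h (R(m := r)) m = K"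
      using upd[OF less.prems(1) m(1)] m(1) by (intro less.hyps) auto
    then show ?thesis
      using upd[OF less.prems(1) m(1)] eq[OF less.prems m(1)] by simp
  qed
qed

lemma sole_demand:
  assumes pat: "pattern R i w j x k y l z" and "t \<in> acceptable z"
    and "t \<notin> acceptable w" "t \<notin> acceptable x" "t \<notin> acceptable y"
  shows "q R l = 0"
proof (rule share_eq_0, rule notI)
  fix \<mu> assume \<mu>: "\<mu> \<in> set_pmf (f R)" "\<mu> l = None"
  have R: "R \<in> profiles" "t \<in> acceptable (R l)" using assms by (auto simp: pattern_def)
  then obtain m where "\<mu> m = Some t" using support_assigned[OF R(1) \<mu>] by blast
  then have "t \<in> acceptable (R m)" using support_acceptable[OF R(1) \<mu>(1)] by blast
  then have "m = l" using assms by (auto simp: pattern_def)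
  then show False using \<open>\<mu> m = Some t\<close> \<mu>(2) by simp
qed

text \<open>After dropping \<open>b\<close>, agent \<open>l\<close> alone accepts \<open>c\<close>
  and is always served. Hence \<open>a\<close> and \<open>c\<close> already exhaust its probability
  under \<open>acb\<close>.\<close>

lemma no_trade_ab:
  assumes pat: "pattern R i ab j ab k ab l acb"
  shows "p R l b = 0"
proof -
  let ?R = "R(l := ac)"
  have pat': "pattern ?R i ab j ab k ab l ac"
    using pat by (auto simp: pattern_def)
  have "q ?R l = 0" by (rule sole_demand[OF pat', of c]) auto
  moreover have "p ?R l a + p ?R l c = p R l a + p R l c"
    by (rule sp2) (use pat in \<open>auto simp: pattern_def\<close>)
  ultimately show ?thesis
    using margins(4)[OF pat] margins(4)[OF pat'] margins(8)[OF pat', of b]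
      share_nonneg[of "f R" l "Some b"] share_nonneg[of "f R" l None] by simp
qed

text \<open>The other three agents keep 1/3 of \<open>b\<close> each when moving between
  \<open>ab\<close> and \<open>abc\<close>, which uses up the column.\<close>

lemma no_trade_almost:
  assumes pat: "pattern R i w j x k y l acb" and sub: "{w, x, y} \<subseteq> {ab, abc}"
  shows "p R l b = 0"
proof -
  let ?C = "{R. pattern R i (R i) j (R j) k (R k) l acb \<and> {R i, R j, R k} \<subseteq> {ab, abc}}"
  have *: "p R m b = 1 / 3" if "m \<in> {i, j, k}" for m
  proof (rule almost_symmetric_share[where C = ?C and r = ab and S = "{i, j, k}"])
    fix R m assume R: "R \<in> ?C" and m: "m \<in> {i, j, k}"
    then have R': "R(m := ab) \<in> ?C" by (auto simp: pattern_def)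
    \<comment> \<open>The share of \<open>a\<close> is constant on the class, so preserving the
      joint share of \<open>a\<close> and \<open>b\<close> preserves that of
      \<open>b\<close>.\<close>
    have a: "p R m a = 1 / 4" if "R \<in> ?C" for R
      by (rule all_top[of R i "R i" j "R j" k "R k" l acb]) (use that m in auto)
    have "R \<in> profiles" "R m \<in> {ab, abc}" using R m by (auto simp: pattern_def)
    then have "p (R(m := ab)) m a + p (R(m := ab)) m b = p R m a + p R m b"
      using sp2(1)[of R m a b "[]" "[c]" "[]" "[c]"] sp2(1)[of R m a b "[c]" "[]" "[]" "[c]"]
      by (auto simp del: fun_upd_apply)
    then show "R(m := ab) \<in> ?C \<and> p (R(m := ab)) m b = p R m b"
      using R' a[OF R] a[OF R'] by simp
  next
    fix R m m' assume R: "R \<in> ?C" and m: "m \<in> {i, j, k}" "m' \<in> {i, j, k}"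
    have "R \<in> profiles" using R by (simp add: pattern_def)
    moreover have "R m \<in> {ab, abc}" using R m(1) by auto
    moreover have "R m' \<in> {ab, abc}" using R m(2) by auto
    ultimately show "p R m b = p R m' b"
      using etae_cases[of R m "[a, b]" c "[]" m' b] by simp
  next
    fix R m assume R: "R \<in> ?C" "\<forall>m\<in>{i, j, k}. R m = ab" and m: "m \<in> {i, j, k}"
    then have pat: "pattern R i ab j ab k ab l acb" by simp
    have "R \<in> profiles" using pat by (simp add: pattern_def)
    then have "p R n b = p R m b" if "n \<in> {i, j, k}" for n
      using R(2) m that by (intro ete) auto
    from this[of i] this[of j] this[of k] show "p R m b = 1 / 3"
      using column3[OF pat, of b] no_trade_ab[OF pat] by simp
  qed (use that pat sub in \<open>auto simp: pattern_def\<close>)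
  have "p R l b \<le> 0"
    using column_pattern_le[OF pat, of b] *[of i] *[of j] *[of k] by simp
  then show ?thesis using share_nonneg[of "f R" l "Some b"] by simp
qed

text \<open>Reporting only \<open>a\<close> leaves \<open>b\<close> to agent \<open>l\<close>; equal treatment of almost equals then carries the \<open>a\<close>-shares over to \<open>ab\<close>.\<close>
abbreviation "only_a \<equiv> ranking [a] [b, c]"

lemma almost_symmetric_a:
  fixes S :: "'n set"
  assumes prof: "\<And>R m. R \<in> C \<Longrightarrow> m \<in> S \<Longrightarrow> R \<in> profiles \<and> R m \<in> {only_a, ab} \<and> R(m := only_a) \<in> C"
    and base: "\<And>R m. R \<in> C \<Longrightarrow> \<forall>m\<in>S. R m = only_a \<Longrightarrow> m \<in> S \<Longrightarrow> p R m a = K"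
    and "R \<in> C" "i \<in> S"
  shows "p R i a = K"
proof (rule almost_symmetric_share[where C = C and S = S and r = only_a])
  fix R m assume "R \<in> C" "m \<in> S"
  then show "R(m := only_a) \<in> C \<and> p (R(m := only_a)) m a = p R m a"
    using prof[of R m] sp1[of R m a "[]" "[b, c]" "[]" "[b, c]"] sp1[of R m a "[b]" "[c]" "[]" "[b, c]"]
    by (auto simp del: fun_upd_apply)
next
  fix R m m' assume "R \<in> C" "m \<in> S" "m' \<in> S"
  then show "p R m a = p R m' a"
    using prof[of R m] prof[of R m'] etae_cases[of R m "[a]" b "[c]" m' a] by simp
qed (use assms in auto)

section \<open>Vanishing shares from agents who accept a single object\<close>

lemma only_a_ba:
  assumes pat: "pattern R i only_a j only_a k only_a l ba"
  shows "p R i a = 1 / 3" "p R j a = 1 / 3" "p R k a = 1 / 3"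
proof -
  let ?R = "R(l := ranking [b] [a, c])"
  have pat': "pattern ?R l (ranking [b] [a, c]) i only_a j only_a k only_a"
    using pat by (auto simp: pattern_def)
  have "p ?R l b = 1"
    using column_single[OF pat', of b] margins(6,7,8)[OF pat', of b] by simp
  moreover have "p ?R l b = p R l b"
    by (rule sp1) (use pat in \<open>auto simp: pattern_def\<close>)
  ultimately have "p R l a = 0"
    using margins(4)[OF pat] share_nonneg[of "f R" l "Some a"] share_nonneg[of "f R" l "Some c"]
      share_nonneg[of "f R" l None] by simp
  moreover have "p R i a = p R k a" "p R j a = p R k a"
    using ete[of R] pat by (auto simp: pattern_def)
  moreover have "p R i a + p R j a + p R k a + p R l a = 1"
    by (rule column_single[OF pat]) simp
  ultimately show "p R i a = 1 / 3" "p R j a = 1 / 3" "p R k a = 1 / 3" by simp_all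
qed

text \<open>If \<open>l\<close> asks for \<open>b\<close> alone, \<open>k\<close> could be served
  for sure by \<open>ac\<close>, so it takes no \<open>b\<close> under \<open>acb\<close> and
  \<open>l\<close> gets \<open>b\<close> for sure. Hence \<open>l\<close> takes no \<open>a\<close>
  under \<open>ba\<close>.\<close>

lemma only_a_acb_ba:
  assumes pat: "pattern R i only_a j only_a k acb l ba"
  shows "p R i a = 1 / 3" "p R j a = 1 / 3"
proof -
  let ?R1 = "R(l := ranking [b] [a, c])"
  have pat1: "pattern ?R1 i only_a j only_a k acb l (ranking [b] [a, c])"
    using pat by (auto simp: pattern_def)
  let ?R2 = "?R1(k := ac)"
  have pat2: "pattern ?R2 i only_a j only_a l (ranking [b] [a, c]) k ac"
    using pat by (auto simp: pattern_def)
  have "q ?R2 k = 0" by (rule sole_demand[OF pat2, of c]) auto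
  moreover have "p ?R2 k a + p ?R2 k c = p ?R1 k a + p ?R1 k c"
    by (rule sp2) (use pat1 in \<open>auto simp: pattern_def\<close>)
  ultimately have "p ?R1 k b = 0"
    using margins(3)[OF pat1] margins(4)[OF pat2] margins(8)[OF pat2, of b]
      share_nonneg[of "f ?R1" k "Some b"] share_nonneg[of "f ?R1" k None] by simp
  moreover have "pattern ?R1 l (ranking [b] [a, c]) i only_a j only_a k acb"
    using pat1 by (auto simp: pattern_def)
  then have "p ?R1 l b + p ?R1 i b + p ?R1 j b + p ?R1 k b = 1"
    by (rule column_single) simp
  ultimately have "p ?R1 l b = 1"
    using margins(5,6)[OF pat1, of b] by simp
  moreover have "p ?R1 l b = p R l b"
    by (rule sp1) (use pat in \<open>auto simp: pattern_def\<close>)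
  ultimately have "p R l a = 0"
    using margins(4)[OF pat] share_nonneg[of "f R" l "Some a"] share_nonneg[of "f R" l "Some c"]
      share_nonneg[of "f R" l None] by simp
  moreover have "p R k a = 1 / 3"
  proof -
    let ?R = "R(k := only_a)"
    have pat': "pattern ?R i only_a j only_a k only_a l ba"
      using pat by (auto simp: pattern_def)
    show ?thesis
      using only_a_ba[OF pat'] sp1[of R k a "[c, b]" "[]" "[]" "[b, c]"] pat by (simp add: pattern_def)
  qed
  moreover have "p R i a = p R j a"
    using ete[of R] pat by (auto simp: pattern_def)
  moreover have "p R i a + p R j a + p R k a + p R l a = 1"
    by (rule column_single[OF pat]) simp
  ultimately show "p R i a = 1 / 3" "p R j a = 1 / 3" by simp_all
qed

text \<open>Each of \<open>i\<close>, \<open>j\<close> and \<open>k\<close> obtains 1/3 of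
  \<open>a\<close>; the value for \<open>k\<close> is computed after moving it to
  \<open>ab\<close>.\<close>

lemma ab_ab_acb_ba_almost:
  assumes pat: "pattern R i ab j ab k acb l ba"
  shows "p R l a = 0"
proof -
  have ij: "p R m a = 1 / 3" if m: "m \<in> {i, j}" for m
  proof (rule almost_symmetric_a[where S = "{i, j}" and
        C = "{R. pattern R i (R i) j (R j) k acb l ba \<and> {R i, R j} \<subseteq> {only_a, ab}}"])
    fix R m assume "R \<in> {R. pattern R i (R i) j (R j) k acb l ba \<and> {R i, R j} \<subseteq> {only_a, ab}}"
      "\<forall>m\<in>{i, j}. R m = only_a" "m \<in> {i, j}"
    then show "p R m a = 1 / 3" using only_a_acb_ba[of R i j k l] by auto
  qed (use m pat in \<open>auto simp: pattern_def\<close>)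
  moreover have "p R k a = 1 / 3"
  proof -
    let ?R = "R(k := ab)"
    have pat': "pattern ?R i ab j ab k ab l ba"
      using pat by (auto simp: pattern_def)
    have "p ?R k a = 1 / 3"
    proof (rule almost_symmetric_a[where S = "{i, j, k}" and
          C = "{R. pattern R i (R i) j (R j) k (R k) l ba \<and> {R i, R j, R k} \<subseteq> {only_a, ab}}"])
      fix R m assume "R \<in> {R. pattern R i (R i) j (R j) k (R k) l ba \<and> {R i, R j, R k} \<subseteq> {only_a, ab}}"
        "\<forall>m\<in>{i, j, k}. R m = only_a" "m \<in> {i, j, k}"
      then show "p R m a = 1 / 3" using only_a_ba[of R i j k l] by auto
    qed (use pat' in \<open>auto simp: pattern_def\<close>)
    then show ?thesis
      using sp1[of R k a "[c, b]" "[]" "[b]" "[c]"] pat by (simp add: pattern_def)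
  qed
  ultimately have "p R l a \<le> 0"
    using column_pattern_le[OF pat, of a] ij[of i] ij[of j] by simp
  then show ?thesis using share_nonneg[of "f R" l "Some a"] by simp
qed

text \<open>Agent \<open>l\<close> can secure \<open>b\<close>, hence never takes \<open>c\<close>;
  then \<open>k\<close> can secure \<open>c\<close>, hence never takes \<open>a\<close>, which
  \<open>i\<close> and \<open>j\<close> split.\<close>

lemma only_a_ca_bc:
  assumes pat: "pattern R i only_a j only_a k ca l bc"
  shows "p R i a = 1 / 2" "p R j a = 1 / 2"
proof -
  let ?R1 = "R(k := ranking [c] [a, b])"
  have pat1: "pattern ?R1 k (ranking [c] [a, b]) i only_a j only_a l bc"
    using pat by (auto simp: pattern_def)
  let ?R2 = "?R1(l := ranking [b] [c, a])"
  have pat2: "pattern ?R2 l (ranking [b] [c, a]) k (ranking [c] [a, b]) i only_a j only_a"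
    using pat by (auto simp: pattern_def)
  have "p ?R2 l b = 1"
    using column_single[OF pat2, of b] margins(6,7,8)[OF pat2, of b] by simp
  moreover have "p ?R2 l b = p ?R1 l b"
    by (rule sp1) (use pat1 in \<open>auto simp: pattern_def\<close>)
  ultimately have "p ?R1 l c = 0"
    using margins(4)[OF pat1] share_nonneg[of "f ?R1" l "Some a"] share_nonneg[of "f ?R1" l "Some c"]
      share_nonneg[of "f ?R1" l None] by simp
  then have "p ?R1 k c = 1"
    using column_single[OF pat1, of c] margins(6,7)[OF pat1, of c] by simp
  moreover have "p ?R1 k c = p R k c"
    by (rule sp1) (use pat in \<open>auto simp: pattern_def\<close>)
  ultimately have "p R k a = 0"
    using margins(3)[OF pat] share_nonneg[of "f R" k "Some a"] share_nonneg[of "f R" k "Some b"]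
      share_nonneg[of "f R" k None] by simp
  moreover have "p R i a = p R j a"
    using ete[of R] pat by (auto simp: pattern_def)
  moreover have "p R i a + p R j a + p R k a + p R l a = 1"
    by (rule column_single[OF pat]) simp
  ultimately show "p R i a = 1 / 2" "p R j a = 1 / 2"
    using margins(8)[OF pat, of a] by simp_all
qed

lemma ab_ab_ca_bc_almost:
  assumes pat: "pattern R i ab j ab k ca l bc"
  shows "p R k a = 0"
proof -
  have ij: "p R m a = 1 / 2" if m: "m \<in> {i, j}" for m
  proof (rule almost_symmetric_a[where S = "{i, j}" and
        C = "{R. pattern R i (R i) j (R j) k ca l bc \<and> {R i, R j} \<subseteq> {only_a, ab}}"])
    fix R m assume "R \<in> {R. pattern R i (R i) j (R j) k ca l bc \<and> {R i, R j} \<subseteq> {only_a, ab}}"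
      "\<forall>m\<in>{i, j}. R m = only_a" "m \<in> {i, j}"
    then show "p R m a = 1 / 2" using only_a_ca_bc[of R i j k l] by auto
  qed (use m pat in \<open>auto simp: pattern_def\<close>)
  then have "p R k a \<le> 0"
    using column_pattern_le[OF pat, of a] ij[of i] ij[of j] share_nonneg[of "f R" l "Some a"] by simp
  then show ?thesis using share_nonneg[of "f R" k "Some a"] by simp
qed

sublocale no_trade_mechanism f a b c
proof
  fix a' b' c' :: 'o and R :: "('n, 'o) profile" and i w j x k y l
  assume "distinct [a', b', c']"
  then interpret other: almost_fair_mechanism f a' b' c'
    using strategy_proof equals almost_equals by unfold_locales
  assume "{w, x, y} \<subseteq> {ranking [a', b'] [c'], ranking [a', b', c'] []}"
    "pattern R i w j x k y l (ranking [a', c', b'] [])"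
  then show "p R l b' = 0" by (intro other.no_trade_almost)
qed

text \<open>Switching \<open>k\<close> to \<open>abc\<close> and \<open>j\<close> to
  \<open>acb\<close> yields the unassigned probabilities 5/24 for \<open>k\<close> and
  \<open>l\<close> and 1/4 for \<open>j\<close>, leaving 1/3 for \<open>i\<close>. The resulting
  5/12 of \<open>b\<close> passes from \<open>i\<close> to its almost equal
  \<open>j\<close>.\<close>

lemma ab_abc_acb_acb_almost:
  assumes pat: "pattern R i ab j abc k acb l acb"
  shows "p R j b = 5 / 12"
proof -
  let ?R1 = "R(k := abc)" and ?R2 = "R(j := acb)"
  have pat1: "pattern ?R1 j abc k abc i ab l acb" and pat2: "pattern ?R2 i ab j acb k acb l acb"
    using pat by (auto simp: pattern_def)
  have "q ?R1 k = q R k"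
    by (rule sp_none) (use pat in \<open>auto simp: pattern_def\<close>)
  then have "q R k = 5 / 24" using abc_abc_ab_none[OF pat1] by simp
  moreover have "q R l = q R k"
    using ete[of R] pat by (auto simp: pattern_def)
  moreover have "q ?R2 j = q R j"
    by (rule sp_none) (use pat in \<open>auto simp: pattern_def\<close>)
  then have "q R j = 1 / 4" using ab_acb_acb_acb[OF pat2] by simp
  moreover have "q R i + q R j + q R k + q R l = 1"
    using column3[OF pat, of a] column3[OF pat, of b] column3[OF pat, of c] margins(1-4)[OF pat] by simp
  moreover have "p R i a = 1 / 4"
    by (rule all_top[OF pat]) auto
  ultimately have "p R i b = 5 / 12"
    using margins(1)[OF pat] margins(5)[OF pat, of c] by simp
  moreover have "p R i b = p R j b"
    by (rule etae[of R i "[a, b]" c "[]"]) (use pat in \<open>auto simp: pattern_def\<close>)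
  ultimately show ?thesis by simp
qed

lemma ab_ab_acb_bc_almost:
  assumes pat: "pattern R i ab j ab k acb l bc"
  shows "1 / 6 \<le> q R l" "p R k c + p R l c \<le> 5 / 6"
  by (rule ab_ab_acb_bc[OF _ _ _ pat]; (rule ab_ab_acb_acb ab_ab_acb_ba_almost ab_ab_ca_bc_almost)?;
      (rule ab_abc_acb_acb_almost)?; assumption)+

end

section \<open>Ex-post efficiency\<close>

text \<open>Moving \<open>i\<close> alone to its outside option, or to an object nobody holds, would
  be a Pareto improvement.\<close>

lemma efficient_imp_non_wasteful:
  assumes "mechanism f" "ex_post_efficient f"
  shows "ex_post_weakly_non_wasteful f"
  unfolding ex_post_weakly_non_wasteful_def weakly_non_wasteful_def
proof (intro ballI allI impI, elim conjE)
  fix R \<mu> i x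
  assume R: "R \<in> profiles" "\<mu> \<in> set_pmf (f R)" and x: "(x, \<mu> i) \<in> R i" "(None, \<mu> i) \<in> R i"
  have eff: "efficient R \<mu>" and as: "\<mu> \<in> assignments"
    using assms R unfolding ex_post_efficient_def mechanism_def by blast+
  have lin: "linear_order (R m)" for m using R(1) by (auto simp: profiles_def preferences_def)
  then have refl: "(y, y) \<in> R m" for y m by (auto simp: order_on_defs refl_on_def)
  have anti: "y = z" if "(y, z) \<in> R m" "(z, y) \<in> R m" for y z m
    using lin[of m] that by (auto simp: order_on_defs antisym_def)
  have improve: "\<mu> i = y" if "(y, \<mu> i) \<in> R i" "\<mu>(i := y) \<in> assignments" for y
  proof (rule ccontr)
    assume "\<mu> i \<noteq> y"
    then have "strict (R i) y (\<mu> i)" using that(1) anti unfolding strict_def by blast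
    moreover have "\<forall>m. ((\<mu>(i := y)) m, \<mu> m) \<in> R m" using that(1) refl by simp
    ultimately show False using eff that(2) unfolding efficient_def by (metis fun_upd_same)
  qed
  have "\<mu>(i := None) \<in> assignments" using as by (auto simp: assignments_def)
  then have None: "\<mu> i = None" using improve x(2) by blast
  show "case x of None \<Rightarrow> \<mu> i = None | Some y \<Rightarrow> \<exists>j. \<mu> j = Some y"
  proof (cases x)
    case (Some y)
    have "\<exists>j. \<mu> j = Some y"
    proof (rule ccontr)
      assume no: "\<nexists>j. \<mu> j = Some y"
      then have "\<mu>(i := Some y) \<in> assignments" using as by (auto simp: assignments_def)
      then show False using improve[of "Some y"] x(1) Some no by simp
    qed
    then show ?thesis using Some by simp
  qed (use None in simp)
qed

locale efficient_mechanism = fair_mechanism f a b c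
  for f :: "('n::finite, 'o::finite) mech" and a b c +
  assumes efficient: "ex_post_efficient f"
begin

section \<open>Exchanges excluded by efficiency\<close>

lemma no_improvement:
  assumes "R \<in> profiles" "\<mu> \<in> set_pmf (f R)" "\<mu>' \<in> assignments"
    and "\<And>m. \<mu>' m = \<mu> m \<or> strict (R m) (\<mu>' m) (\<mu> m)"
  shows "\<mu>' m = \<mu> m"
proof (rule ccontr)
  assume "\<mu>' m \<noteq> \<mu> m"
  then have "strict (R m) (\<mu>' m) (\<mu> m)" using assms(4) by blast
  moreover have "(y, y) \<in> R n" for y n
    using assms(1) by (auto simp: profiles_def preferences_def order_on_defs refl_on_def)
  then have "\<forall>n. (\<mu>' n, \<mu> n) \<in> R n"
    using assms(4) unfolding strict_def by metis
  moreover have "efficient R \<mu>"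
    using efficient assms(1,2) unfolding ex_post_efficient_def by blast
  ultimately show False
    using assms(3) unfolding efficient_def by blast
qed

lemma support_assignments: "R \<in> profiles \<Longrightarrow> \<mu> \<in> set_pmf (f R) \<Longrightarrow> \<mu> \<in> assignments"
  using mechanism unfolding mechanism_def by blast

lemma preferred_assigned:
  assumes "R \<in> profiles" "\<mu> \<in> set_pmf (f R)" "strict (R i) (Some x) (\<mu> i)"
  shows "\<exists>j. \<mu> j = Some x"
proof (rule ccontr)
  assume no: "\<nexists>j. \<mu> j = Some x"
  have "(\<mu>(i := Some x)) i = \<mu> i"
  proof (rule no_improvement[where \<mu>' = "\<mu>(i := Some x)" and m = i, OF assms(1,2)])
    show "\<mu>(i := Some x) \<in> assignments"
      using support_assignments[OF assms(1,2)] no by (auto simp: assignments_def)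
  qed (use assms(3) in auto)
  then show False using no by (metis fun_upd_same)
qed

text \<open>Otherwise \<open>i\<close> would take a free \<open>x\<close>, or swap with a willing
  holder of it.\<close>

lemma preferred_holder:
  assumes "R \<in> profiles" "\<mu> \<in> set_pmf (f R)" "\<mu> i = Some y" "strict (R i) (Some x) (Some y)"
  shows "\<exists>j. \<mu> j = Some x \<and> x \<in> acceptable (R j) \<and> \<not> strict (R j) (Some y) (Some x)"
proof -
  obtain j where j: "\<mu> j = Some x"
    using preferred_assigned[of R \<mu> i x] assms by auto
  have "x \<noteq> y" using assms(4) by (auto simp: strict_def)
  have "\<not> strict (R j) (Some y) (Some x)"
  proof
    assume s: "strict (R j) (Some y) (Some x)"
    have "(\<mu>(i := Some x, j := Some y)) j = \<mu> j"
    proof (rule no_improvement[where \<mu>' = "\<mu>(i := Some x, j := Some y)" and m = j, OF assms(1,2)])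
      show "\<mu>(i := Some x, j := Some y) \<in> assignments"
        using support_assignments[OF assms(1,2)] assms(3) j \<open>x \<noteq> y\<close> unfolding assignments_def
        by (auto; metis)
    qed (use assms j s in auto)
    then show False using j \<open>x \<noteq> y\<close> by simp
  qed
  then show ?thesis using j support_acceptable[OF assms(1,2) j] by blast
qed

lemma no_cycle:
  assumes "R \<in> profiles" "\<mu> \<in> set_pmf (f R)" "\<mu> i = Some x" "\<mu> j = Some y" "\<mu> k = Some z" "distinct [x, y, z]"
    and "strict (R i) (Some y) (Some x)" "strict (R j) (Some z) (Some y)" "strict (R k) (Some x) (Some z)"
  shows False
proof -
  have ne: "i \<noteq> j" "i \<noteq> k" "j \<noteq> k" using assms(3-6) by auto
  have "(\<mu>(i := Some y, j := Some z, k := Some x)) i = \<mu> i"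
  proof (rule no_improvement[where \<mu>' = "\<mu>(i := Some y, j := Some z, k := Some x)" and m = i, OF assms(1,2)])
    show "\<mu>(i := Some y, j := Some z, k := Some x) \<in> assignments"
      using support_assignments[OF assms(1,2)] assms(3-6) ne unfolding assignments_def
      by (auto; metis)
  qed (use assms ne in auto)
  then show False using assms(3,6) ne by simp
qed

lemma no_share:
  assumes "R \<in> profiles" "strict (R i) (Some x) (Some y)"
    and "\<And>j. j \<noteq> i \<Longrightarrow> x \<in> acceptable (R j) \<Longrightarrow> strict (R j) (Some y) (Some x)"
  shows "p R i y = 0"
proof (rule share_eq_0, rule notI)
  fix \<mu> assume \<mu>: "\<mu> \<in> set_pmf (f R)" "\<mu> i = Some y"
  then obtain j where "\<mu> j = Some x" "x \<in> acceptable (R j)" "\<not> strict (R j) (Some y) (Some x)"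
    using preferred_holder[OF assms(1)] assms(2) by blast
  moreover have "x \<noteq> y" using assms(2) by (auto simp: strict_def)
  ultimately show False using assms(3)[of j] \<mu>(2) by (cases "j = i") auto
qed

lemma acceptable_pattern:
  assumes "pattern R i w j x k y l z" "t \<in> acceptable (R m)"
  shows "m = i \<or> m = j \<or> m = k \<or> m = l"
  using assms by (intro ccontr[where P = "_ \<or> _"]) (auto simp: pattern_def)

text \<open>Agent \<open>l\<close> would swap \<open>b\<close> for \<open>c\<close> with any holder
  of \<open>c\<close>, all of whom rank \<open>b\<close> higher.\<close>

lemma no_share_b:
  assumes pat: "pattern R i w j x k y l acb" and sub: "{w, x, y} \<subseteq> {ab, abc, bac}"
  shows "p R l b = 0"
proof (rule no_share)
  have "strict r (Some b) (Some c)" if "r \<in> {ab, abc, bac}" for r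
    using that by (auto simp: strict_ranking rank_def)
  moreover have "R m \<in> {ab, abc, bac}" if "m \<noteq> l" "c \<in> acceptable (R m)" for m
    using acceptable_pattern[OF pat that(2)] that(1) pat sub unfolding pattern_def by blast
  ultimately show "strict (R m) (Some b) (Some c)" if "m \<noteq> l" "c \<in> acceptable (R m)" for m
    using that by blast
qed (use pat in \<open>auto simp: pattern_def strict_ranking rank_def\<close>)

lemma no_share_a:
  assumes pat: "pattern R i w j x k y l z" and sub: "{w, x, y} \<subseteq> {ab, abc, ac, acb}" and "z \<in> {ba, bac}"
  shows "p R l a = 0"
proof (rule no_share)
  have "strict r (Some a) (Some b)" if "r \<in> {ab, abc, ac, acb}" for r
    using that by (auto simp: strict_ranking rank_def)
  moreover have "R m \<in> {ab, abc, ac, acb}" if "m \<noteq> l" "b \<in> acceptable (R m)" for m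
    using acceptable_pattern[OF pat that(2)] that(1) pat sub unfolding pattern_def by blast
  ultimately show "strict (R m) (Some a) (Some b)" if "m \<noteq> l" "b \<in> acceptable (R m)" for m
    using that by blast
qed (use assms in \<open>auto simp: pattern_def strict_ranking rank_def\<close>)

text \<open>If \<open>k\<close> held \<open>a\<close>, then \<open>l\<close> would hold
  \<open>c\<close> and one of \<open>i\<close>, \<open>j\<close> would hold \<open>b\<close>, and
  these three would trade in a cycle.\<close>

lemma no_share_ca:
  assumes pat: "pattern R i ab j ab k ca l bc"
  shows "p R k a = 0"
proof (rule share_eq_0, rule notI)
  fix \<mu> assume \<mu>: "\<mu> \<in> set_pmf (f R)" "\<mu> k = Some a"
  have R: "R \<in> profiles" using pat by (simp add: pattern_def)
  have kl: "strict (R k) (Some c) (Some a)" "strict (R l) (Some b) (Some c)"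
    "strict (R i) (Some a) (Some b)" "strict (R j) (Some a) (Some b)"
    using pat by (auto simp: pattern_def strict_ranking rank_def)
  obtain m where m: "\<mu> m = Some c" "c \<in> acceptable (R m)"
    using preferred_holder[OF R \<mu> kl(1)] by blast
  then have "m \<noteq> i" "m \<noteq> j" "m \<noteq> k" using pat \<mu>(2) by (auto simp: pattern_def)
  then have "m = l" using acceptable_pattern[OF pat m(2)] by blast
  then obtain n where n: "\<mu> n = Some b" "b \<in> acceptable (R n)"
    using preferred_holder[OF R \<mu>(1) _ kl(2)] m by blast
  then have "n \<noteq> k" "n \<noteq> l" using \<mu>(2) m(1) \<open>m = l\<close> by auto
  then have "n = i \<or> n = j" using acceptable_pattern[OF pat n(2)] by blast
  then show False
    using no_cycle[OF R \<mu>(1), of k a l c n b] \<mu>(2) m n kl \<open>m = l\<close> by auto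
qed

text \<open>If \<open>k\<close> held \<open>b\<close>, both \<open>a\<close> and \<open>c\<close>
  would need holders unwilling to swap for \<open>b\<close>; only \<open>l\<close> qualifies, and it
  cannot hold both.\<close>

lemma no_share_b_bac_bac:
  assumes pat: "pattern R i bac j bac k acb l ac"
  shows "p R k b = 0"
proof (rule share_eq_0, rule notI)
  fix \<mu> assume \<mu>: "\<mu> \<in> set_pmf (f R)" "\<mu> k = Some b"
  have R: "R \<in> profiles" using pat by (simp add: pattern_def)
  have holder: "m = l" if m: "\<mu> m = Some x" "x \<in> acceptable (R m)" "\<not> strict (R m) (Some b) (Some x)" "x \<noteq> b" for m x
  proof -
    have "strict bac (Some b) (Some x)"
      using strict_ranking_prefix[of b "[b]" "Some x" "[a, c]" "[]"] m(4) by simp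
    then have "R m \<noteq> bac" using m(3) by metis
    then have "m \<noteq> i" "m \<noteq> j" using pat by (auto simp: pattern_def)
    moreover have "m \<noteq> k" using m(1,4) \<mu>(2) by auto
    ultimately show ?thesis using acceptable_pattern[OF pat m(2)] by blast
  qed
  have "strict (R k) (Some c) (Some b)" "strict (R k) (Some a) (Some b)"
    using pat by (auto simp: pattern_def strict_ranking rank_def)
  then have "\<mu> l = Some c" "\<mu> l = Some a"
    using preferred_holder[OF R \<mu>] holder by (metis objects_neq)+
  then show False by simp
qed

text \<open>If \<open>b\<close> were left over, \<open>i\<close> and \<open>j\<close> would each
  have to hold \<open>a\<close>, the only other object they may not want to give up for
  \<open>b\<close>.\<close>

lemma column_top2:
  assumes pat: "pattern R i w j x k y l z" and sub: "{w, x} \<subseteq> {abc, bac}"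
  shows "p R i b + p R j b + p R k b + p R l b = 1"
proof -
  have R: "R \<in> profiles" using pat by (simp add: pattern_def)
  have "\<exists>m. \<mu> m = Some b" if \<mu>: "\<mu> \<in> set_pmf (f R)" for \<mu>
  proof (rule ccontr)
    assume no: "\<nexists>m. \<mu> m = Some b"
    have "\<mu> m = Some a" if m: "R m \<in> {abc, bac}" for m
    proof (rule ccontr)
      assume "\<mu> m \<noteq> Some a"
      then have "\<mu> m = None \<or> \<mu> m = Some c"
        using support_acceptable[OF R \<mu>, of m] no m by (cases "\<mu> m") auto
      then have "strict (R m) (Some b) (\<mu> m)"
        using m by (auto simp: strict_ranking rank_def)
      then show False using preferred_assigned[OF R \<mu>] no by blast
    qed
    then have "\<mu> i = Some a" "\<mu> j = Some a" using pat sub by (auto simp: pattern_def)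
    then show False using support_injective[OF R \<mu>] pat by (auto simp: pattern_def)
  qed
  then show ?thesis using column_eq[OF R] column_pattern[OF pat, of b] by metis
qed

sublocale no_trade_mechanism f a b c
proof
  fix a' b' c' :: 'o and R :: "('n, 'o) profile" and i w j x k y l
  assume "distinct [a', b', c']"
  then interpret other: efficient_mechanism f a' b' c'
    using strategy_proof equals efficient by unfold_locales
  assume sub: "{w, x, y} \<subseteq> {ranking [a', b'] [c'], ranking [a', b', c'] []}"
    and pat: "pattern R i w j x k y l (ranking [a', c', b'] [])"
  show "p R l b' = 0" by (rule other.no_share_b[OF pat]) (use sub in blast)
qed

section \<open>The detour through \<open>bac\<close>\<close>

lemma three_top_bac:
  assumes pat: "pattern R i w j x k y l bac" and sub: "{w, x, y} \<subseteq> {ab, abc, ac, acb}"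
  shows "p R i a = 1 / 3" "p R j a = 1 / 3" "p R k a = 1 / 3" "p R l a = 0"
proof -
  show l: "p R l a = 0"
    by (rule no_share_a[OF pat sub]) simp
  have "p R m a = 1 / 3" if m: "m \<in> {i, j, k}" for m
  proof (rule symmetric3[where L = "{ab, abc, ac, acb}" and r = ab, OF _ _ _ _ _ pat sub m])
    fix R :: "('n, 'o) profile" and m assume "R \<in> profiles" "R m \<in> {ab, abc, ac, acb}"
    then have "R \<in> profiles" "R m \<in> tops a" by auto
    then show "p (R(m := ab)) m a = p R m a" by (metis sp1 topsE)
  next
    fix R w x y assume pat: "pattern R i w j x k y l bac" and sub: "{w, x, y} \<subseteq> {ab, abc, ac, acb}"
    have ex: "\<exists>u v. r = ranking (a # u) v \<and> set u \<subseteq> {a, b, c}" if "r \<in> {ab, abc, ac, acb}" for r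
      using that by auto
    obtain u1 v1 where 1: "w = ranking (a # u1) v1" "set u1 \<subseteq> {a, b, c}" using ex[of w] sub by auto
    obtain u2 v2 where 2: "x = ranking (a # u2) v2" "set u2 \<subseteq> {a, b, c}" using ex[of x] sub by auto
    obtain u3 v3 where 3: "y = ranking (a # u3) v3" "set u3 \<subseteq> {a, b, c}" using ex[of y] sub by auto
    have "p R i a + p R j a + p R k a + p R l a = 1"
      by (rule column3[OF pat[unfolded 1 2 3]]) (use 1 2 3 in auto)
    moreover have "p R l a = 0"
      by (rule no_share_a[OF pat sub]) simp
    ultimately show "p R i a + p R j a + p R k a = 1" by simp
  qed (auto intro: ete)
  then show "p R i a = 1 / 3" "p R j a = 1 / 3" "p R k a = 1 / 3" by auto
qed

text \<open>Reporting \<open>acb\<close>, agent \<open>l\<close> never receives \<open>b\<close>, so dropping \<open>b\<close> changes nothing for it.\<close>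
lemma drop_b:
  assumes pat: "pattern R i w j x k y l ac" and sub: "{w, x, y} \<subseteq> {ab, abc, bac}"
  shows "q R l = q (R(l := abc)) l"
proof -
  let ?R = "R(l := acb)"
  have pat': "pattern ?R i w j x k y l acb"
    using pat by (auto simp: pattern_def)
  have R: "R \<in> profiles" "R l = ac" "?R \<in> profiles" "?R l = acb"
    using pat by (auto simp: pattern_def)
  have "p ?R l b = 0"
    by (rule no_share_b[OF pat' sub])
  moreover have "p ?R l a + p ?R l c = p R l a + p R l c"
    by (rule sp2) (use R in auto)
  moreover have "q (?R(l := abc)) l = q ?R l"
    by (rule sp_none[OF R(3,4)]) auto
  ultimately show ?thesis
    using row[of R l "{a, b, c}"] row[of ?R l "{a, b, c}"] p_eq_0[of R b l] R by simp
qed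

text \<open>By \<open>drop_b\<close> agent \<open>l\<close> fares as under \<open>abc\<close>, where
  \<open>all_full\<close> applies; the other three average the remaining 3/4.\<close>

lemma three_full_ac:
  assumes pat: "pattern R i w j x k y l ac" and sub: "{w, x, y} \<subseteq> {abc, bac}"
  shows "q R i = 1 / 4" "q R j = 1 / 4" "q R k = 1 / 4" "q R l = 1 / 4"
proof -
  have l: "q R l = 1 / 4" if pat: "pattern R i w j x k y l ac" and sub: "{w, x, y} \<subseteq> {abc, bac}" for R w x y
  proof -
    have "pattern (R(l := abc)) i w j x k y l abc" using pat by (auto simp: pattern_def)
    then have "q (R(l := abc)) l = 1 / 4" by (rule all_full) (use sub in auto)
    moreover have "q R l = q (R(l := abc)) l" by (rule drop_b[OF pat]) (use sub in auto)
    ultimately show ?thesis by simp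
  qed
  have "q R m = (3 / 4) / 3" if m: "m \<in> {i, j, k}" for m
  proof (rule symmetric3[where L = "{abc, bac}" and r = abc, OF _ _ _ _ _ pat sub m])
    fix R :: "('n, 'o) profile" and m assume "R \<in> profiles" "R m \<in> {abc, bac}"
    then show "q (R(m := abc)) m = q R m"
      using sp_none[of R m "[a, b, c]" "[]" "[a, b, c]" "[]"] sp_none[of R m "[b, a, c]" "[]" "[a, b, c]" "[]"]
      by (auto simp del: fun_upd_apply)
  next
    fix R w x y assume pat: "pattern R i w j x k y l ac" and sub: "{w, x, y} \<subseteq> {abc, bac}"
    have ex: "\<exists>u v. r = ranking u v \<and> set u = {a, b, c}" if "r \<in> {abc, bac}" for r
    proof -
      have "r \<in> full" using that by auto
      then show ?thesis by (elim fullE) blast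
    qed
    obtain u1 v1 where 1: "w = ranking u1 v1" "set u1 = {a, b, c}" using ex[of w] sub by auto
    obtain u2 v2 where 2: "x = ranking u2 v2" "set u2 = {a, b, c}" using ex[of x] sub by auto
    obtain u3 v3 where 3: "y = ranking u3 v3" "set u3 = {a, b, c}" using ex[of y] sub by auto
    note pat' = pat[unfolded 1 2 3]
    have col: "p R i t + p R j t + p R k t + p R l t = 1" if "t \<in> {a, b, c}" for t
      by (rule column3[OF pat']) (use 1 2 3 that in auto)
    show "q R i + q R j + q R k = 3 / 4"
      using col[of a] col[of b] col[of c] margins(1-4)[OF pat'] 1 2 3 l[OF pat sub] by simp
  qed (auto intro: ete)
  then show "q R i = 1 / 4" "q R j = 1 / 4" "q R k = 1 / 4" "q R l = 1 / 4"
    using l[OF pat sub] by auto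
qed

lemma ab_bac_abc_ac:
  assumes pat: "pattern R i ab j bac k abc l ac"
  shows "q R k = 1 / 6"
proof -
  have l: "q R l = 1 / 6"
  proof -
    let ?R = "R(l := abc)" let ?R1 = "?R(j := abc)"
    have pat': "pattern ?R i ab j bac k abc l abc" and pat1: "pattern ?R1 j abc k abc l abc i ab"
      using pat by (auto simp: pattern_def)
    have "q ?R1 j = q ?R j"
      by (rule sp_none) (use pat' in \<open>auto simp: pattern_def\<close>)
    then have "q ?R j = 1 / 6" using abc_abc_abc_ab[OF pat1] by simp
    moreover have "q ?R i = 1 / 2"
      using pair_total[OF pat', of i] margins(1)[OF pat'] margins(5)[OF pat', of c] by simp
    moreover have "q ?R k = q ?R l"
      by (rule ete) (use pat' in \<open>auto simp: pattern_def\<close>)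
    moreover have "q ?R i + q ?R j + q ?R k + q ?R l = 1"
      using column3[OF pat', of a] column3[OF pat', of b] column3[OF pat', of c] margins(1-4)[OF pat'] by simp
    moreover have "q R l = q ?R l" by (rule drop_b[OF pat]) simp
    ultimately show ?thesis by simp
  qed
  have j: "q R j = 5 / 24"
  proof -
    let ?R = "R(j := abc)"
    have pat': "pattern ?R j abc k abc i ab l ac"
      using pat by (auto simp: pattern_def)
    have "q ?R j = q R j"
      by (rule sp_none) (use pat in \<open>auto simp: pattern_def\<close>)
    then show ?thesis using abc_abc_ab_none[OF pat'] by simp
  qed
  \<comment> \<open>With \<open>i\<close> at \<open>abc\<close>, agent \<open>j\<close> gets no
    \<open>a\<close> but keeps 7/12 as its joint share, all of it in \<open>b\<close>. The equals
    \<open>i\<close> and \<open>k\<close> split the other 5/12, so \<open>i\<close> has 1/3 + 5/24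
    from its first two objects.\<close>
  have i: "q R i = 11 / 24"
  proof -
    let ?R = "R(i := abc)" let ?R1 = "?R(j := abc)"
    have pat': "pattern ?R i abc k abc l ac j bac" and pat1: "pattern ?R1 i abc j abc k abc l ac"
      using pat by (auto simp: pattern_def)
    have "p ?R1 j a + p ?R1 j b = 7 / 12"
      using three_top[OF pat1] by simp
    moreover have "p ?R1 j b + p ?R1 j a = p ?R j b + p ?R j a"
      by (rule sp2) (use pat' in \<open>auto simp: pattern_def\<close>)
    moreover have "p ?R i a = 1 / 3" "p ?R j a = 0"
      using three_top_bac[OF pat'] by auto
    moreover have "p ?R i b = p ?R k b"
      by (rule ete) (use pat' in \<open>auto simp: pattern_def\<close>)
    ultimately have "p ?R i a + p ?R i b = 13 / 24"
      using column3[OF pat', of b] margins(7)[OF pat', of b] by simp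
    moreover have "p ?R i a + p ?R i b = p R i a + p R i b"
      by (rule sp2) (use pat in \<open>auto simp: pattern_def\<close>)
    ultimately show ?thesis
      using margins(1)[OF pat] margins(5)[OF pat, of c] by simp
  qed
  have "q R i + q R j + q R k + q R l = 1"
    using column3[OF pat, of a] column3[OF pat, of b] column3[OF pat, of c] margins(1-4)[OF pat] by simp
  then show ?thesis using i j l by simp
qed

text \<open>The value of \<open>l\<close> comes from \<open>acb\<close> by dropping
  \<open>b\<close>, that of \<open>i\<close> from \<open>abc\<close> by dropping \<open>c\<close>;
  the second uses the interpretation with \<open>b\<close> and \<open>c\<close> exchanged.\<close>

lemma ab_acb_acb_ac:
  assumes pat: "pattern R i ab j acb k acb l ac"
  shows "q R j = 5 / 24"
proof -
  interpret dual: no_trade_mechanism f a c b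
    using mechanism strategy_proof equals non_wasteful no_trade by unfold_locales simp_all
  let ?R = "R(l := acb)" let ?R1 = "R(i := abc)" let ?R2 = "?R1(i := acb)"
  have pat': "pattern ?R i ab j acb k acb l acb" and pat1: "pattern ?R1 j acb k acb l ac i abc"
    and pat2: "pattern ?R2 j acb k acb i acb l ac"
    using pat by (auto simp: pattern_def)
  have top: "p R m a = 1 / 4" if "m \<in> {i, j, k, l}" for m
    by (rule all_top[OF pat]) (use that in auto)
  have "p ?R l a = 1 / 4" by (rule all_top[OF pat']) auto
  moreover have "p ?R l a + p ?R l c = p R l a + p R l c"
    by (rule sp2) (use pat in \<open>auto simp: pattern_def\<close>)
  ultimately have "q R l = 5 / 12"
    using ab_acb_acb_acb[OF pat'] top[of l] margins(4)[OF pat] margins(8)[OF pat, of b] by simp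
  moreover have "q ?R2 i = q ?R1 i"
    by (rule sp_none) (use pat1 in \<open>auto simp: pattern_def\<close>)
  then have "q ?R1 i = 1 / 6" "p ?R1 i c = 0"
    using dual.abc_abc_abc_ab[OF pat2] dual.three_top[OF pat1] by auto
  then have "p ?R1 i a + p ?R1 i b = 5 / 6"
    using margins(4)[OF pat1] by simp
  moreover have "p ?R1 i a + p ?R1 i b = p R i a + p R i b"
    by (rule sp2) (use pat in \<open>auto simp: pattern_def\<close>)
  ultimately have "q R i = 1 / 6" "q R l = 5 / 12"
    using margins(1)[OF pat] margins(5)[OF pat, of c] by auto
  moreover have "q R j = q R k"
    by (rule ete) (use pat in \<open>auto simp: pattern_def\<close>)
  moreover have "q R i + q R j + q R k + q R l = 1"
    using column3[OF pat, of a] column3[OF pat, of b] column3[OF pat, of c] margins(1-4)[OF pat] by simp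
  ultimately show ?thesis by simp
qed

lemma bac_bac_ac_ac:
  assumes pat: "pattern R i bac j bac k ac l ac"
  shows "q R i = 1 / 4"
proof -
  let ?R = "R(k := acb)" let ?R1 = "?R(k := bac)"
  have pat': "pattern ?R i bac j bac k acb l ac" and pat1: "pattern ?R1 i bac j bac k bac l ac"
    using pat by (auto simp: pattern_def)
  have "q ?R1 k = q ?R k"
    by (rule sp_none) (use pat' in \<open>auto simp: pattern_def\<close>)
  then have "q ?R k = 1 / 4" "p ?R k b = 0"
    using three_full_ac[OF pat1] no_share_b_bac_bac[OF pat'] by auto
  moreover have "p ?R k a + p ?R k c = p R k a + p R k c"
    by (rule sp2) (use pat in \<open>auto simp: pattern_def\<close>)
  ultimately have "q R k = 1 / 4"
    using margins(3)[OF pat] margins(7)[OF pat, of b] margins(3)[OF pat'] by simp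
  moreover have "q R k = q R l" "q R i = q R j"
    using ete[of R] pat by (auto simp: pattern_def)
  moreover have "q R i + q R j + q R k + q R l = 1"
    using column3[OF pat, of a] column_top2[OF pat] column3[OF pat, of c] margins(1-4)[OF pat] by simp
  ultimately show ?thesis by simp
qed

lemma abc_bac_acb_ac:
  assumes pat: "pattern R i abc j bac k acb l ac"
  shows "p R i a = 1 / 3" "p R i b = 1 / 4"
proof -
  let ?R1 = "R(j := abc)" let ?R2 = "R(k := ac)" let ?R3 = "?R2(j := abc)"
  let ?R4 = "R(k := abc)" let ?R5 = "?R1(k := abc)" let ?R6 = "?R2(i := bac)"
  have pat0: "pattern R i abc k acb l ac j bac"
    and pat1: "pattern ?R1 i abc j abc k acb l ac" and pat2: "pattern ?R2 i abc j bac k ac l ac"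
    and pat2': "pattern ?R2 i abc k ac l ac j bac"
    and pat3: "pattern ?R3 i abc j abc k ac l ac" and pat4: "pattern ?R4 i abc j bac k abc l ac"
    and pat5: "pattern ?R5 i abc j abc k abc l ac" and pat6: "pattern ?R6 i bac j bac k ac l ac"
    using pat by (auto simp: pattern_def)
  \<comment> \<open>The unknown \<open>h\<close> is carried along: \<open>j\<close> has 3/4 - h/2 of
    \<open>b\<close> and \<open>k\<close> has h/2, so it cancels in the column of
    \<open>b\<close>.\<close>
  define h where "h = p ?R1 k b"
  have top0: "p R i a = 1 / 3" "p R k a = 1 / 3" "p R j a = 0"
    using three_top_bac[OF pat0] by auto
  have top1: "p ?R1 m a = 1 / 4" if "m \<in> {i, j, k, l}" for m
    by (rule all_top[OF pat1]) (use that in auto)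
  have top3: "p ?R3 m a = 1 / 4" if "m \<in> {i, j, k, l}" for m
    by (rule all_top[OF pat3]) (use that in auto)
  have "p ?R1 i b = p ?R1 j b"
    by (rule ete) (use pat1 in \<open>auto simp: pattern_def\<close>)
  then have "p ?R1 j b = (1 - h) / 2"
    using column3[OF pat1, of b] margins(8)[OF pat1, of b] by (simp add: h_def)
  moreover have "p ?R1 j b + p ?R1 j a = p R j b + p R j a"
    by (rule sp2) (use pat in \<open>auto simp: pattern_def\<close>)
  ultimately have jb: "p R j b = 3 / 4 - h / 2"
    using top0 top1[of j] by (simp add: field_simps)
  have "q ?R5 k = q ?R1 k"
    by (rule sp_none) (use pat1 in \<open>auto simp: pattern_def\<close>)
  then have "q ?R1 k = 1 / 4"
    using three_full_ac[OF pat5] by simp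
  moreover have "p (?R1(k := ac)) k a + p (?R1(k := ac)) k c = p ?R1 k a + p ?R1 k c"
    by (rule sp2) (use pat1 in \<open>auto simp: pattern_def\<close>)
  moreover have "?R1(k := ac) = ?R3"
    using pat by (auto simp: pattern_def fun_upd_twist)
  ultimately have "q ?R3 k = 1 / 4 + h"
    using margins(3)[OF pat1] margins(3)[OF pat3] margins(7)[OF pat3, of b] by (simp add: h_def)
  moreover have "q ?R3 k = q ?R3 l" "q ?R3 i = q ?R3 j"
    using ete[of ?R3] pat3 unfolding pattern_def by metis+
  moreover have "q ?R3 i + q ?R3 j + q ?R3 k + q ?R3 l = 1"
    using column3[OF pat3, of a] column_top2[OF pat3] column3[OF pat3, of c] margins(1-4)[OF pat3] by simp
  moreover have "q ?R3 j = q ?R2 j"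
    by (rule sp_none) (use pat2 in \<open>auto simp: pattern_def\<close>)
  ultimately have "q ?R2 j = 1 / 4 - h" by simp
  moreover have "q ?R6 i = q ?R2 i"
    by (rule sp_none) (use pat2 in \<open>auto simp: pattern_def\<close>)
  then have "q ?R2 i = 1 / 4" using bac_bac_ac_ac[OF pat6] by simp
  moreover have "q ?R2 k = q ?R2 l"
    using ete[of ?R2] pat2 unfolding pattern_def by metis
  moreover have "q ?R2 i + q ?R2 j + q ?R2 k + q ?R2 l = 1"
    using column3[OF pat2, of a] column_top2[OF pat2] column3[OF pat2, of c] margins(1-4)[OF pat2] by simp
  ultimately have "q ?R2 k = 1 / 4 + h / 2" by simp
  moreover have "q ?R4 k = q R k"
    by (rule sp_none) (use pat in \<open>auto simp: pattern_def\<close>)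
  then have "q R k = 1 / 4" using three_full_ac[OF pat4] by simp
  moreover have "p ?R2 k a + p ?R2 k c = p R k a + p R k c"
    by (rule sp2) (use pat in \<open>auto simp: pattern_def\<close>)
  ultimately have "p R k b = h / 2"
    using margins(3)[OF pat] margins(3)[OF pat2] margins(7)[OF pat2, of b] by simp
  then show "p R i a = 1 / 3" "p R i b = 1 / 4"
    using top0 jb column3[OF pat, of b] margins(8)[OF pat, of b] by auto
qed

text \<open>Changing one report of \<open>i\<close>, \<open>j\<close> and \<open>k\<close> at a time
  gives their unassigned probabilities 5/12, 5/24 and 1/6, which leaves 5/24 for
  \<open>l\<close>.\<close>

lemma ab_bac_acb_ac:
  assumes pat: "pattern R i ab j bac k acb l ac"
  shows "p R l c = 11 / 24"
proof -
  let ?R1 = "R(i := abc)" let ?R2 = "R(j := acb)" let ?R3 = "R(k := abc)"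
  have pat0: "pattern R i ab k acb l ac j bac"
    and pat1: "pattern ?R1 i abc j bac k acb l ac" and pat2: "pattern ?R2 i ab j acb k acb l ac"
    and pat3: "pattern ?R3 i ab j bac k abc l ac"
    using pat by (auto simp: pattern_def)
  have "p ?R1 i a + p ?R1 i b = p R i a + p R i b"
    by (rule sp2) (use pat in \<open>auto simp: pattern_def\<close>)
  then have "q R i = 5 / 12"
    using abc_bac_acb_ac[OF pat1] margins(1)[OF pat] margins(5)[OF pat, of c] by simp
  moreover have "q ?R2 j = q R j"
    by (rule sp_none) (use pat in \<open>auto simp: pattern_def\<close>)
  moreover have "q ?R3 k = q R k"
    by (rule sp_none) (use pat in \<open>auto simp: pattern_def\<close>)
  moreover have "q R i + q R j + q R k + q R l = 1"
    using column3[OF pat, of a] column3[OF pat, of b] column3[OF pat, of c] margins(1-4)[OF pat] by simp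
  ultimately have "q R l = 5 / 24"
    using ab_acb_acb_ac[OF pat2] ab_bac_abc_ac[OF pat3] by simp
  then show ?thesis
    using three_top_bac[OF pat0] margins(4)[OF pat] margins(8)[OF pat, of b] by simp
qed

lemma ab_bac_acb_acb:
  assumes pat: "pattern R i ab j bac k acb l acb"
  shows "p R j c = 1 / 12" "p R j a = 0"
proof -
  let ?R = "R(l := ac)"
  have pat0: "pattern R i ab k acb l acb j bac" and pat1: "pattern ?R i ab j bac k acb l ac"
    and pat2: "pattern ?R i ab k acb l ac j bac"
    using pat by (auto simp: pattern_def)
  have "p ?R l a + p ?R l c = p R l a + p R l c"
    by (rule sp2) (use pat in \<open>auto simp: pattern_def\<close>)
  moreover have "p ?R l a = 1 / 3" "p R l a = 1 / 3" "p R j a = 0"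
    using three_top_bac[OF pat0] three_top_bac[OF pat2] by auto
  ultimately have "p R l c = 11 / 24"
    using ab_bac_acb_ac[OF pat1] by simp
  moreover have "p R k c = p R l c"
    by (rule ete) (use pat in \<open>auto simp: pattern_def\<close>)
  ultimately show "p R j c = 1 / 12" "p R j a = 0"
    using column3[OF pat, of c] margins(5)[OF pat, of c] \<open>p R j a = 0\<close> by auto
qed

text \<open>Agent \<open>j\<close> is unassigned with probability 1/4. Under \<open>bac\<close> it
  gets 1/12 of \<open>c\<close>, so its joint share of \<open>a\<close> and \<open>b\<close> is 2/3,
  of which \<open>a\<close> takes 1/4 under \<open>abc\<close>.\<close>

lemma ab_abc_acb_acb_efficient:
  assumes pat: "pattern R i ab j abc k acb l acb"
  shows "p R j b = 5 / 12"
proof -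
  let ?R1 = "R(j := bac)" let ?R2 = "R(j := acb)"
  have pat1: "pattern ?R1 i ab j bac k acb l acb" and pat2: "pattern ?R2 i ab j acb k acb l acb"
    using pat by (auto simp: pattern_def)
  have "q ?R1 j = q R j"
    by (rule sp_none) (use pat in \<open>auto simp: pattern_def\<close>)
  moreover have "q ?R2 j = q R j"
    by (rule sp_none) (use pat in \<open>auto simp: pattern_def\<close>)
  moreover have "p ?R1 j a + p ?R1 j b = p R j a + p R j b"
    by (rule sp2) (use pat in \<open>auto simp: pattern_def\<close>)
  moreover have "p R j a = 1 / 4"
    by (rule all_top[OF pat]) auto
  ultimately show ?thesis
    using ab_bac_acb_acb[OF pat1] ab_acb_acb_acb[OF pat2] margins(2)[OF pat] margins(2)[OF pat1] by simp
qed

lemma ab_ab_acb_bc_efficient: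
  assumes pat: "pattern R i ab j ab k acb l bc"
  shows "1 / 6 \<le> q R l" "p R k c + p R l c \<le> 5 / 6"
proof -
  have 1: "1 / 6 \<le> q R l" if "pattern R i ab j ab k acb l acb" for R
    using ab_ab_acb_acb[OF ab_abc_acb_acb_efficient that] .
  have 2: "p R l a = 0" if "pattern R i ab j ab k acb l ba" for R
    by (rule no_share_a[OF that]) auto
  have 3: "p R k a = 0" if "pattern R i ab j ab k ca l bc" for R
    by (rule no_share_ca[OF that])
  show "1 / 6 \<le> q R l" "p R k c + p R l c \<le> 5 / 6"
    using ab_ab_acb_bc[OF 1 2 3 pat] by simp_all
qed

end

section \<open>The wasteful profile\<close>

text \<open>Only \<open>k\<close> and \<open>l\<close> accept \<open>c\<close>, so the bound on
  their shares is a bound on the waste of \<open>c\<close>, and \<open>l\<close> is the agent who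
  would want it.\<close>

lemma (in non_wasteful_mechanism) wasteful_pattern:
  assumes pat: "pattern R i (ranking [a, b] [c]) j (ranking [a, b] [c]) k (ranking [a, c, b] []) l (ranking [b, c] [a])"
    and abc: "distinct [a, b, c]" and none: "1 / 6 \<le> q R l" and c: "p R k c + p R l c \<le> 5 / 6"
  shows "agent_object_wasteful (1 / 6) f"
proof -
  have R: "R \<in> profiles" using pat by (simp add: pattern_def)
  have "p R m c = 0" if "m \<notin> {k, l}" for m
  proof -
    have "R m = ranking [a, b] [c] \<or> R m = ranking [] []"
      using pat that by (cases "m = i \<or> m = j") (auto simp: pattern_def)
    then have "c \<notin> acceptable (R m)" using abc by auto
    then show ?thesis using p_eq_0[OF R] by blast
  qed
  then have "(\<Sum>m\<in>UNIV. p R m c) = (\<Sum>m\<in>{k, l}. p R m c)"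
    by (intro sum.mono_neutral_right) auto
  also have "\<dots> = p R k c + p R l c"
    using pat by (simp add: pattern_def)
  finally have "unassigned_share (f R) c = 1 - (p R k c + p R l c)"
    unfolding unassigned_share_def by (simp only:)
  then have "1 / 6 \<le> unassigned_share (f R) c" using c by linarith
  moreover have "R l = ranking [b, c] [a]" using pat by (simp add: pattern_def)
  then have "strict (R l) (Some c) None" by (simp add: strict_ranking_None)
  ultimately have "strict (R l) (Some c) None \<and> 1 / 6 \<le> min (q R l) (unassigned_share (f R) c)"
    using none by simp
  then show ?thesis
    using R unfolding agent_object_wasteful_def by blast
qed

theorem theorem1:
  fixes f :: "('n::finite, 'o::finite) mech"
  assumes "CARD('n) \<ge> 4" and "CARD('o) \<ge> 3" and "mechanism f"
  shows "(equal_treatment_of_almost_equals f \<and> strategy_proof f \<and> ex_post_weakly_non_wasteful f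
            \<longrightarrow> (\<exists>q\<in>{0..1}. q \<ge> 1/6 \<and> agent_object_wasteful q f)) \<and>
         (equal_treatment_of_equals f \<and> strategy_proof f \<and> ex_post_efficient f
            \<longrightarrow> (\<exists>q\<in>{0..1}. q \<ge> 1/6 \<and> agent_object_wasteful q f))"
proof -
  obtain N :: "'n set" where "card N = 4"
    using obtain_subset_with_card_n[OF assms(1)] by auto
  then obtain ms where "set ms = N" "distinct ms" "length ms = 4"
    by (metis card.infinite distinct_card finite_distinct_list zero_neq_numeral)
  then obtain i j k l :: 'n where ijkl: "distinct [i, j, k, l]"
    by (auto simp: numeral_eq_Suc length_Suc_conv)
  obtain X :: "'o set" where "card X = 3"
    using obtain_subset_with_card_n[OF assms(2)] by auto
  then obtain a b c where abc: "distinct [a, b, c :: 'o]"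
    by (auto simp: card_3_iff)
  define R where "R = (\<lambda>_ :: 'n. ranking [] [] :: 'o pref)
    (i := ranking [a, b] [c], j := ranking [a, b] [c], k := ranking [a, c, b] [], l := ranking [b, c] [a])"
  have pat: "pattern R i (ranking [a, b] [c]) j (ranking [a, b] [c]) k (ranking [a, c, b] []) l (ranking [b, c] [a])"
    using ijkl by (auto simp: R_def pattern_def profiles_def)
  have "agent_object_wasteful (1 / 6) f"
    if "equal_treatment_of_almost_equals f" "strategy_proof f" "ex_post_weakly_non_wasteful f"
  proof -
    interpret non_wasteful_mechanism f
      using assms(3) that by unfold_locales
    interpret almost_fair_mechanism f a b c
      using that abc almost_equals_imp_equals by unfold_locales auto
    show ?thesis
      by (rule wasteful_pattern[OF pat abc ab_ab_acb_bc_almost[OF pat]])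
  qed
  moreover have "agent_object_wasteful (1 / 6) f"
    if "equal_treatment_of_equals f" "strategy_proof f" "ex_post_efficient f"
  proof -
    interpret efficient_mechanism f a b c
      using assms(3) that abc efficient_imp_non_wasteful[OF assms(3) that(3)] by unfold_locales auto
    show ?thesis
      by (rule wasteful_pattern[OF pat abc ab_ab_acb_bc_efficient[OF pat]])
  qed
  ultimately show ?thesis by (auto intro!: bexI[of _ "1 / 6"])
qed

end
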